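(* Let $T$ be large and $y>2$ real. For each $1\leq j\leq \pi(y)$ let $I_j\subset(0,1)$ be an open interval of length $\delta_j>0$, and let $$M=\mathrm{meas}\left\{t\in[T,2T]:\ \left\{\frac{t\log p_j}{2\pi}\right\}\in I_j\text{ for all }1\le j\le\pi(y)\right\}.$$ Then $M\sim T\prod_{j\leq\pi(y)}\delta_j$ as $T\to\infty$, uniformly for $y\leq \sqrt{\log T}/(\log_2T)^2$ and $\delta_j>(\log_2 T)^{-5/3}$ for all $j$.
   Context: $p_j$ denotes the $j$-th smallest prime, $\pi(y)$ the number of primes up to $y$, $\{\cdot\}$ the fractional part, $\log_2=\log\log$, and meas the Lebesgue measure. *)

theory Defs
  imports
    "HOL-Analysis.Analysis"
    "HOL-Computational_Algebra.Primes"
    "HOL-Library.Infinite_Set"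
begin

(* enumerate counts from 0, primes are indexed from 1; the value at 0 is never used *)
definition nth_prime :: "nat \<Rightarrow> nat" where
  "nth_prime j = enumerate {p. prime p} (j - 1)"

definition prime_pi :: "real \<Rightarrow> nat" where
  "prime_pi y = card {p :: nat. prime p \<and> real p \<le> y}"

abbreviation loglog :: "real \<Rightarrow> real" where
  "loglog T \<equiv> ln (ln T)"

definition hit_set :: "real \<Rightarrow> real \<Rightarrow> (nat \<Rightarrow> real set) \<Rightarrow> real set" where
  "hit_set T y I =
     {t \<in> {T..2 * T}. \<forall>j\<in>{1..prime_pi y}. frac (t * ln (real (nth_prime j)) / (2 * pi)) \<in> I j}"

definition hit_measure :: "real \<Rightarrow> real \<Rightarrow> (nat \<Rightarrow> real set) \<Rightarrow> real" where
  "hit_measure T y I = measure lebesgue (hit_set T y I)"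

end

theory Submission
  imports Defs "HOL-Real_Asymp.Real_Asymp"
begin

text \<open>
  Each indicator function of an interval is approximated by its convolution with the normalised
  \<open>2r\<close>-th power of a Dirichlet kernel of length \<open>n\<close>, which has mass \<open>1\<close>, degree at most \<open>r n\<close>, and is
  exponentially small in \<open>r\<close> at distance \<open>\<ge> 6 / n\<close> from the integers. Widening or shrinking the interval by
  \<open>6 / n\<close> on both sides turns the convolution into a majorant or a minorant up to a tiny error.
  A product of such trigonometric polynomials, evaluated at \<open>t ln p\<^sub>j / (2 pi)\<close>, is a sum of terms
  \<open>cis (w t)\<close> with \<open>w = \<Sum>j. m\<^sub>j ln p\<^sub>j\<close>. By unique factorisation \<open>w \<noteq> 0\<close> unless all \<open>m\<^sub>j\<close> vanish, and then
  \<open>\<bar>w\<bar> \<ge> y powr (- r n N)\<close> with \<open>N\<close> the number of primes, so only the constant terms contribute to the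
  mean over \<open>[T, 2T]\<close>.
\<close>

section \<open>A concentrated trigonometric kernel\<close>

definition trig :: "(int \<Rightarrow> complex) \<Rightarrow> nat \<Rightarrow> real \<Rightarrow> complex" where
  "trig c K x = (\<Sum>m\<in>{- int K..int K}. c m * cis (2 * pi * of_int m * x))"

lemma prod_cis: "finite S \<Longrightarrow> (\<Prod>i\<in>S. cis (f i)) = cis (\<Sum>i\<in>S. f i)"
  by (induction S rule: finite_induct) (auto simp: cis_mult)

lemma cis_two_pi_int [simp]: "cis (2 * pi * of_int m) = 1"
  by (metis cis_multiple_2pi Ints_of_int)

lemma trig_periodic: "trig c K (x + of_int j) = trig c K x"
proof -
  have "cis (2 * pi * of_int m * (x + of_int j)) = cis (2 * pi * of_int m * x)" for m
  proof -
    have "2 * pi * of_int m * (x + of_int j) = 2 * pi * of_int m * x + 2 * pi * of_int (m * j)"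
      by (simp add: algebra_simps)
    then show ?thesis by (metis cis_mult cis_two_pi_int mult.right_neutral)
  qed
  then show ?thesis by (simp add: trig_def)
qed

lemma continuous_on_trig [continuous_intros]:
  "continuous_on S f \<Longrightarrow> continuous_on S (\<lambda>x. trig c K (f x))"
  unfolding trig_def by (intro continuous_intros)

text \<open>Real trigonometric polynomials are carried throughout as real functions tied to complex
  coefficients by this hypothesis, because the mean value estimate needs the coefficients
  themselves. Continuity follows by taking real parts.\<close>

lemma trig_real_continuous:
  assumes "\<And>x. complex_of_real (P x) = trig c K x"
  shows "continuous_on S P"
proof -
  have "P = (\<lambda>v. Re (trig c K v))" by (simp flip: assms)
  moreover have "continuous_on S (\<lambda>v. Re (trig c K v))" by (intro continuous_intros)
  ultimately show ?thesis by simp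
qed

lemma cis_has_integral:
  assumes "w \<noteq> 0" "\<alpha> \<le> \<beta>"
  shows "((\<lambda>t. cis (w * t)) has_integral (cis (w * \<beta>) - cis (w * \<alpha>)) / (\<i> * of_real w)) {\<alpha>..\<beta>}"
proof -
  have "((\<lambda>t. cis (w * t) / (\<i> * of_real w)) has_vector_derivative cis (w * t)) (at t within {\<alpha>..\<beta>})" for t
  proof -
    have "((\<lambda>t. exp (\<i> * of_real w * of_real t) / (\<i> * of_real w)) has_vector_derivative
        exp (\<i> * of_real w * of_real t)) (at t within {\<alpha>..\<beta>})"
      using assms(1) by (auto intro!: derivative_eq_intros has_vector_derivative_real_field)
    then show ?thesis by (simp add: cis_conv_exp mult.assoc)
  qed
  from fundamental_theorem_of_calculus[OF assms(2) this]
  show ?thesis by (simp add: diff_divide_distrib)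
qed

text \<open>The antiderivative has constant norm 1 / \<bar>w\<bar>, so the bound does not grow with
  the interval. This is why a nonzero frequency contributes little to an integral over an interval
  of length \<open>T\<close>.\<close>

lemma norm_integral_cis_le:
  assumes "w \<noteq> 0" "\<alpha> \<le> \<beta>"
  shows "norm (integral {\<alpha>..\<beta>} (\<lambda>t. cis (w * t))) \<le> 2 / \<bar>w\<bar>"
proof -
  have "norm (cis (w * \<beta>) - cis (w * \<alpha>)) \<le> 2"
    using norm_triangle_ineq4[of "cis (w * \<beta>)" "cis (w * \<alpha>)"] by simp
  then show ?thesis
    unfolding integral_unique[OF cis_has_integral[OF assms]]
    by (simp add: norm_divide norm_mult divide_right_mono)
qed

text \<open>Orthogonality: every nonconstant exponential integrates to 0 over a full period.\<close>

lemma trig_integral_period: "integral {\<alpha>..\<alpha> + 1} (trig c K) = c 0"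
proof -
  have i: "integral {\<alpha>..\<alpha> + 1} (\<lambda>x. cis (2 * pi * of_int m * x)) = (if m = 0 then 1 else 0)" for m
  proof (cases "m = 0")
    case False
    have "cis (2 * pi * of_int m * (\<alpha> + 1)) = cis (2 * pi * of_int m * \<alpha>)"
      by (simp add: distrib_left flip: cis_mult)
    then show ?thesis
      using integral_unique[OF cis_has_integral[of "2 * pi * of_int m" \<alpha> "\<alpha> + 1"]] False by simp
  qed auto
  have "integral {\<alpha>..\<alpha> + 1} (trig c K) =
      (\<Sum>m\<in>{- int K..int K}. integral {\<alpha>..\<alpha> + 1} (\<lambda>x. c m * cis (2 * pi * of_int m * x)))"
    unfolding trig_def
    by (intro integral_sum) (auto intro!: integrable_continuous_interval continuous_on_mult continuous_on_cis continuous_on_const continuous_on_id)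
  also have "\<dots> = (\<Sum>m\<in>{- int K..int K}. if m = 0 then c 0 else 0)"
    by (intro sum.cong) (auto simp: i)
  also have "\<dots> = c 0" by simp
  finally show ?thesis .
qed

section \<open>The Dirichlet kernel and its normalised powers\<close>

lemma cos_ge_half: "\<bar>x\<bar> \<le> pi / 3 \<Longrightarrow> 1 / 2 \<le> cos x"
  using cos_monotone_0_pi_le[of "\<bar>x\<bar>" "pi / 3"] pi_gt_zero by (simp add: cos_60)

text \<open>The one-sided form differs from a symmetric kernel only by a phase factor, and only its
  norm matters below; the squared norm is \<open>n\<close> times the Fejer kernel.\<close>

definition dirichlet_kernel :: "nat \<Rightarrow> real \<Rightarrow> complex" where
  "dirichlet_kernel n v = (\<Sum>m<n. cis (2 * pi * real m * v))"

text \<open>So close to 0, all \<open>n\<close> phases lie within sixty degrees of the positive real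
  axis, so each term has real part at least 1/2.\<close>

lemma dirichlet_kernel_ge:
  assumes "0 \<le> v" "v \<le> 1 / (6 * real n)" "n > 0"
  shows "real n / 2 \<le> norm (dirichlet_kernel n v)"
proof -
  have "1 / 2 \<le> cos (2 * pi * real m * v)" if "m < n" for m
  proof (rule cos_ge_half)
    have "real m * v \<le> real n * (1 / (6 * real n))"
      using that assms by (intro mult_mono) auto
    then have "real m * v \<le> 1 / 6" using assms by simp
    then have "2 * pi * (real m * v) \<le> 2 * pi * (1 / 6)" by (intro mult_left_mono) auto
    then show "\<bar>2 * pi * real m * v\<bar> \<le> pi / 3" using assms by (simp add: abs_mult mult.assoc)
  qed
  then have "(\<Sum>m<n. 1 / 2) \<le> (\<Sum>m<n. cos (2 * pi * real m * v))" by (intro sum_mono) auto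
  also have "\<dots> = Re (dirichlet_kernel n v)" by (simp add: dirichlet_kernel_def)
  also have "\<dots> \<le> norm (dirichlet_kernel n v)" by (rule complex_Re_le_cmod)
  finally show ?thesis by simp
qed

text \<open>At the point \<eta> itself this is the mean value theorem together with pi \<ge> 2;
  monotonicity carries it up to 1/2, and the symmetry v \<mapsto> 1 - v covers the rest.\<close>

lemma sin_pi_mult_ge:
  assumes "\<eta> \<ge> 0" "\<eta> \<le> 1 / 6" "\<eta> \<le> v" "v \<le> 1 - \<eta>"
  shows "\<eta> \<le> sin (pi * v)"
proof -
  have base: "\<eta> \<le> sin (pi * \<eta>)"
  proof (cases "\<eta> = 0")
    case False
    obtain z where z: "0 < z" "z < pi * \<eta>" "sin (pi * \<eta>) - sin 0 = (pi * \<eta> - 0) * cos z"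
      using MVT2[of 0 "pi * \<eta>" sin cos] False assms pi_gt_zero by (auto intro: derivative_eq_intros)
    have "pi * \<eta> \<le> pi * (1/6)" using assms by (intro mult_left_mono) auto
    then have "z \<le> pi / 3" using z(2) pi_gt_zero by linarith
    then have "1 / 2 \<le> cos z" using z(1) by (intro cos_ge_half) auto
    have "\<eta> = (2 * \<eta>) * (1 / 2)" by simp
    also have "\<dots> \<le> (pi * \<eta>) * cos z"
      using \<open>1 / 2 \<le> cos z\<close> assms pi_ge_two by (intro mult_mono mult_right_mono) auto
    also have "\<dots> = sin (pi * \<eta>)" using z(3) by simp
    finally show ?thesis .
  qed simp
  have m: "sin (pi * \<eta>) \<le> sin (pi * u)" if "\<eta> \<le> u" "u \<le> 1 / 2" for u
  proof -
    have "pi * u \<le> pi * (1 / 2)" "pi * \<eta> \<le> pi * u" "0 \<le> pi * \<eta>"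
      using that assms by (auto intro: mult_left_mono)
    then show ?thesis by (intro sin_monotone_2pi_le) (auto intro: order_trans[of _ 0])
  qed
  show ?thesis
  proof (cases "v \<le> 1 / 2")
    case True then show ?thesis using m[of v] base assms by simp
  next
    case False
    have "sin (pi * (1 - v)) = sin (pi * v)" by (simp add: right_diff_distrib)
    then show ?thesis using m[of "1 - v"] base False assms by simp
  qed
qed

text \<open>The kernel is a geometric sum: the numerator has norm at most 2, and the denominator has
  norm 2 sin (pi v), which is at least 2 \<eta>.\<close>

lemma dirichlet_kernel_le:
  assumes "\<eta> > 0" "\<eta> \<le> 1 / 6" "\<eta> \<le> v" "v \<le> 1 - \<eta>"
  shows "norm (dirichlet_kernel n v) \<le> 1 / \<eta>"
proof -
  define z where "z = cis (2 * pi * v)"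
  have D: "dirichlet_kernel n v = (\<Sum>m<n. z ^ m)"
    unfolding dirichlet_kernel_def z_def
    by (intro sum.cong refl) (simp only: Complex.DeMoivre mult.commute mult.left_commute)
  have e: "(1 - z) * dirichlet_kernel n v = 1 - z ^ n"
    unfolding D by (simp add: sum_gp_strict algebra_simps one_diff_power_eq)
  have "norm (1 - z ^ n) \<le> 2"
    using norm_triangle_ineq4[of 1 "z ^ n"] by (simp add: norm_power z_def)
  then have le2: "norm (1 - z) * norm (dirichlet_kernel n v) \<le> 2"
    by (metis e norm_mult)
  have "(norm (1 - z))\<^sup>2 = (2 * sin (pi * v))\<^sup>2"
  proof -
    have "(norm (1 - z))\<^sup>2 = (1 - cos (2 * (pi * v)))\<^sup>2 + (sin (2 * (pi * v)))\<^sup>2"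
      by (simp add: z_def cmod_power2 mult.assoc)
    also have "\<dots> = 2 - 2 * cos (2 * (pi * v))"
      using sin_cos_squared_add[of "2 * (pi * v)"] by (simp add: power2_eq_square algebra_simps)
    also have "\<dots> = (2 * sin (pi * v))\<^sup>2"
      by (simp add: cos_double_sin power_mult_distrib)
    finally show ?thesis .
  qed
  moreover have "0 \<le> 2 * sin (pi * v)"
    using sin_pi_mult_ge[of \<eta> v] assms by linarith
  ultimately have n1: "norm (1 - z) = 2 * sin (pi * v)"
    by (rule power2_eq_imp_eq[OF _ norm_ge_zero])
  have "2 * \<eta> * norm (dirichlet_kernel n v) \<le> norm (1 - z) * norm (dirichlet_kernel n v)"
    using sin_pi_mult_ge[of \<eta> v] assms by (intro mult_right_mono) (auto simp: n1)
  with le2 have "\<eta> * norm (dirichlet_kernel n v) \<le> 1" by simp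
  then show ?thesis using assms by (simp add: field_simps)
qed

text \<open>Writing the squared norm as kernel times conjugate and expanding its \<open>r\<close>-th
  power, the coefficient \<open>a m\<close> counts the \<open>r\<close>-tuples of index pairs whose
  differences add up to \<open>m\<close>. Counting yields nonnegativity and the total, which is the
  number of all tuples.\<close>

lemma dirichlet_kernel_power_trig:
  "\<exists>a :: int \<Rightarrow> real. (\<forall>m. a m \<ge> 0) \<and> (\<Sum>m\<in>{- int (r * n)..int (r * n)}. a m) = real n ^ (2 * r) \<and>
    (\<forall>v. of_real (norm (dirichlet_kernel n v) ^ (2 * r)) = trig (\<lambda>m. of_real (a m)) (r * n) v)"
proof -
  define A where "A = {..<n} \<times> {..<n}"
  define G where "G = ({..<r} \<rightarrow>\<^sub>E A)"
  define h :: "(nat \<Rightarrow> nat \<times> nat) \<Rightarrow> int"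
    where "h g = (\<Sum>i<r. int (fst (g i)) - int (snd (g i)))" for g
  define a :: "int \<Rightarrow> real" where "a m = real (card {g \<in> G. h g = m})" for m
  have fin: "finite A" "finite G" by (auto simp: A_def G_def intro: finite_PiE)
  have hK: "h ` G \<subseteq> {- int (r * n)..int (r * n)}"
  proof
    fix y assume "y \<in> h ` G"
    then obtain g where g: "g \<in> G" "y = h g" by auto
    have "\<bar>h g\<bar> \<le> (\<Sum>i<r. \<bar>int (fst (g i)) - int (snd (g i))\<bar>)"
      unfolding h_def by (rule sum_abs)
    also have "\<dots> \<le> (\<Sum>i<r. int n)"
    proof (rule sum_mono)
      fix i assume "i \<in> {..<r}"
      then have "g i \<in> A" using g by (auto simp: G_def)
      then show "\<bar>int (fst (g i)) - int (snd (g i))\<bar> \<le> int n" by (auto simp: A_def)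
    qed
    finally show "y \<in> {- int (r * n)..int (r * n)}" using g by auto
  qed
  have "of_real (norm (dirichlet_kernel n v) ^ (2 * r)) = trig (\<lambda>m. of_real (a m)) (r * n) v" for v
  proof -
    have sq: "complex_of_real ((norm (dirichlet_kernel n v))\<^sup>2) =
        (\<Sum>p\<in>A. cis (2 * pi * v * of_int (int (fst p) - int (snd p))))"
    proof -
      have "complex_of_real ((norm (dirichlet_kernel n v))\<^sup>2) =
          dirichlet_kernel n v * cnj (dirichlet_kernel n v)"
        by (simp only: complex_norm_square)
      also have "\<dots> = (\<Sum>p<n. \<Sum>q<n. cis (2 * pi * v * of_int (int p - int q)))"
        by (simp add: dirichlet_kernel_def sum_product cis_mult cis_cnj algebra_simps)
      finally show ?thesis by (simp add: A_def sum.cartesian_product case_prod_beta)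
    qed
    have "complex_of_real (norm (dirichlet_kernel n v) ^ (2 * r)) =
        (\<Prod>i<r. \<Sum>p\<in>A. cis (2 * pi * v * of_int (int (fst p) - int (snd p))))"
      by (simp only: power_mult of_real_power sq[symmetric] prod_constant card_lessThan)
    also have "\<dots> = (\<Sum>g\<in>G. \<Prod>i<r. cis (2 * pi * v * of_int (int (fst (g i)) - int (snd (g i)))))"
      unfolding G_def by (rule prod_sum_PiE) (auto simp: fin)
    also have "\<dots> = (\<Sum>g\<in>G. cis (2 * pi * of_int (h g) * v))"
      by (intro sum.cong) (auto simp: prod_cis h_def sum_distrib_left sum_distrib_right mult_ac)
    also have "\<dots> = (\<Sum>m\<in>{- int (r * n)..int (r * n)}. \<Sum>g\<in>{g \<in> G. h g = m}. cis (2 * pi * of_int (h g) * v))"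
      by (rule sum.group[symmetric]) (use fin hK in auto)
    also have "\<dots> = trig (\<lambda>m. of_real (a m)) (r * n) v"
      unfolding trig_def by (intro sum.cong) (auto simp: a_def)
    finally show ?thesis .
  qed
  moreover have "(\<Sum>m\<in>{- int (r * n)..int (r * n)}. a m) = real n ^ (2 * r)"
  proof -
    have "(\<Sum>m\<in>{- int (r * n)..int (r * n)}. a m) =
        (\<Sum>m\<in>{- int (r * n)..int (r * n)}. \<Sum>g\<in>{g \<in> G. h g = m}. 1)"
      by (simp add: a_def)
    also have "\<dots> = (\<Sum>g\<in>G. 1)"
      by (rule sum.group) (use fin hK in auto)
    also have "\<dots> = real n ^ (2 * r)"
      by (simp add: G_def A_def card_PiE power_mult power2_eq_square)
    finally show ?thesis .
  qed
  ultimately show ?thesis by (intro exI[of _ a]) (auto simp: a_def)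
qed

text \<open>The \<open>2 r\<close>-th power of the kernel norm is divided by its mean
  \<open>a 0\<close>. A lower bound for the mean turns the total of the coefficients and the bound
  on the kernel away from the integers into the two estimates claimed.\<close>

lemma concentrated_kernel:
  assumes n: "n > 0"
  obtains k :: "real \<Rightarrow> real" and a :: "int \<Rightarrow> complex" where
    "\<And>v. of_real (k v) = trig a (r * n) v" "a 0 = 1" "\<And>v. k v \<ge> 0"
    "(\<Sum>m\<in>{- int (r * n)..int (r * n)}. norm (a m)) \<le> 6 * real n * 4 ^ r"
    "\<And>(\<eta> :: real) v. \<lbrakk>0 < \<eta>; \<eta> \<le> 1 / 6; \<eta> \<le> v; v \<le> 1 - \<eta>\<rbrakk> \<Longrightarrow> k v \<le> 6 * real n * (2 / (real n * \<eta>)) ^ (2 * r)"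
proof -
  obtain a :: "int \<Rightarrow> real" where a: "\<And>m. a m \<ge> 0"
    "(\<Sum>m\<in>{- int (r * n)..int (r * n)}. a m) = real n ^ (2 * r)"
    "\<And>v. of_real (norm (dirichlet_kernel n v) ^ (2 * r)) = trig (\<lambda>m. of_real (a m)) (r * n) v"
    using dirichlet_kernel_power_trig[of r n] by blast
  define f where "f v = norm (dirichlet_kernel n v) ^ (2 * r)" for v
  have fc: "continuous_on S f" for S
    unfolding f_def dirichlet_kernel_def by (intro continuous_intros)
  have "integral {0..0+1} (\<lambda>v. complex_of_real (f v)) = of_real (a 0)"
    unfolding f_def a(3) using trig_integral_period[of 0 "\<lambda>m. of_real (a m)"] by simp
  moreover have "integral {0..0+1} (\<lambda>v. complex_of_real (f v)) = of_real (integral {0..1} f)"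
    using integral_linear[OF integrable_continuous_interval[OF fc] bounded_linear_of_real, of 0 1]
    by (simp add: o_def)
  ultimately have a0: "a 0 = integral {0..1} f" by (metis of_real_eq_iff)
  have f0: "f v \<ge> 0" for v by (simp add: f_def)
  \<comment> \<open>Only the peak on \<open>{0..1 / (6 * real n)}\<close> is kept, where the
    function is at least \<open>(real n / 2) ^ (2 * r)\<close>.\<close>
  have Z: "(real n / 2) ^ (2 * r) / (6 * real n) \<le> a 0"
  proof -
    have "(real n / 2) ^ (2 * r) / (6 * real n) = integral {0..1 / (6 * real n)} (\<lambda>_. (real n / 2) ^ (2 * r))"
      by simp
    also have "\<dots> \<le> integral {0..1 / (6 * real n)} f"
      using n by (intro integral_le integrable_continuous_interval fc)
         (auto simp: f_def intro!: power_mono dirichlet_kernel_ge)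
    also have "\<dots> \<le> integral {0..1} f"
      using n f0 by (intro integral_subset_le integrable_continuous_interval fc) (auto simp: field_simps)
    finally show ?thesis using a0 by simp
  qed
  have Zpos: "(real n / 2) ^ (2 * r) / (6 * real n) > 0" using n by simp
  with Z have apos: "a 0 > 0" by linarith
  have inv: "1 / a 0 \<le> 6 * real n * (2 / real n) ^ (2 * r)"
  proof -
    have "1 / a 0 \<le> 1 / ((real n / 2) ^ (2 * r) / (6 * real n))"
      using Z Zpos by (intro frac_le) auto
    also have "\<dots> = 6 * real n * (2 / real n) ^ (2 * r)" by (simp add: power_divide field_simps)
    finally show ?thesis .
  qed
  show ?thesis
  proof (rule that[of "\<lambda>v. f v / a 0" "\<lambda>m. of_real (a m / a 0)"])
    show "of_real (f v / a 0) = trig (\<lambda>m. of_real (a m / a 0)) (r * n) v" for v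
    proof -
      have "trig (\<lambda>m. of_real (a m / a 0)) (r * n) v = trig (\<lambda>m. of_real (a m)) (r * n) v / of_real (a 0)"
        by (simp add: trig_def sum_divide_distrib)
      then show ?thesis by (simp add: a(3)[symmetric] f_def)
    qed
    show "(\<Sum>m\<in>{- int (r * n)..int (r * n)}. norm (complex_of_real (a m / a 0))) \<le> 6 * real n * 4 ^ r"
    proof -
      have "(\<Sum>m\<in>{- int (r * n)..int (r * n)}. norm (complex_of_real (a m / a 0))) =
          (\<Sum>m\<in>{- int (r * n)..int (r * n)}. a m) * (1 / a 0)"
        using a(1) apos by (simp add: sum_divide_distrib norm_divide)
      also have "\<dots> \<le> real n ^ (2 * r) * (6 * real n * (2 / real n) ^ (2 * r))"
        unfolding a(2) by (intro mult_left_mono inv) auto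
      also have "\<dots> = 6 * real n * 4 ^ r" using n by (simp add: power_divide power_mult)
      finally show ?thesis .
    qed
    fix \<eta> v :: real assume h: "0 < \<eta>" "\<eta> \<le> 1 / 6" "\<eta> \<le> v" "v \<le> 1 - \<eta>"
    have "f v * (1 / a 0) \<le> (1 / \<eta>) ^ (2 * r) * (6 * real n * (2 / real n) ^ (2 * r))"
      unfolding f_def using dirichlet_kernel_le[OF h] apos by (intro mult_mono inv power_mono) auto
    also have "\<dots> = 6 * real n * (2 / (real n * \<eta>)) ^ (2 * r)"
      by (simp add: power_divide power_mult_distrib)
    finally show "f v / a 0 \<le> 6 * real n * (2 / (real n * \<eta>)) ^ (2 * r)" by simp
  qed (use apos f0 in auto)
qed

section \<open>Trigonometric majorants and minorants of intervals\<close>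

text \<open>The integral is the convolution of \<open>k\<close> with the indicator of the interval
  from \<alpha> to \<beta>. Convolution multiplies the \<open>m\<close>-th coefficient by the
  Fourier coefficient \<open>J m\<close> of that indicator, whose norm is at most the length of the
  interval.\<close>

lemma trig_convolve_interval:
  fixes k :: "real \<Rightarrow> real"
  assumes k: "\<And>v. of_real (k v) = trig a K v" and "a 0 = 1" and ab: "\<alpha> \<le> \<beta>"
  obtains c where "\<And>x. of_real (integral {x - \<beta>..x - \<alpha>} k) = trig c K x"
    "c 0 = of_real (\<beta> - \<alpha>)" "\<And>m. norm (c m) \<le> norm (a m) * (\<beta> - \<alpha>)"
proof -
  define J :: "int \<Rightarrow> complex" where "J m = integral {-\<beta>..-\<alpha>} (\<lambda>v. cis (2 * pi * of_int m * v))" for m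
  show ?thesis
  proof (rule that[of "\<lambda>m. a m * J m"])
    have kc: "continuous_on S k" for S by (rule trig_real_continuous[OF k])
    fix x
    have "of_real (integral {x - \<beta>..x - \<alpha>} k) = integral {x - \<beta>..x - \<alpha>} (\<lambda>v. complex_of_real (k v))"
      using integral_linear[OF integrable_continuous_interval[OF kc] bounded_linear_of_real[where 'a = complex], of "x - \<beta>" "x - \<alpha>"]
      by (simp add: o_def)
    also have "\<dots> = integral {-\<beta>..-\<alpha>} (\<lambda>v. trig a K (v + x))"
      unfolding k using integral_shift_real_ivl[of "x - \<beta>" x "x - \<alpha>" "trig a K"] by simp
    also have "\<dots> = integral {-\<beta>..-\<alpha>} (\<lambda>v. \<Sum>m\<in>{- int K..int K}.
        (a m * cis (2 * pi * of_int m * x)) * cis (2 * pi * of_int m * v))"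
      unfolding trig_def by (simp add: distrib_left mult_ac flip: cis_mult)
    also have "\<dots> = (\<Sum>m\<in>{- int K..int K}. (a m * cis (2 * pi * of_int m * x)) * J m)"
      unfolding J_def
      by (subst integral_sum)
        (auto intro!: integrable_continuous_interval continuous_on_mult continuous_on_cis
          continuous_on_const continuous_on_id)
    also have "\<dots> = trig (\<lambda>m. a m * J m) K x" by (simp add: trig_def mult_ac)
    finally show "of_real (integral {x - \<beta>..x - \<alpha>} k) = trig (\<lambda>m. a m * J m) K x" .
  next
    show "a 0 * J 0 = of_real (\<beta> - \<alpha>)" using assms by (simp add: J_def scaleR_conv_of_real)
  next
    fix m
    have "norm (J m) \<le> 1 * (- \<alpha> - - \<beta>)"
      unfolding J_def using ab
      by (intro integral_bound continuous_on_cis continuous_on_mult continuous_on_const continuous_on_id) auto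
    then show "norm (a m * J m) \<le> norm (a m) * (\<beta> - \<alpha>)"
      by (simp add: norm_mult mult_left_mono)
  qed
qed

text \<open>The kernel is nonnegative, has mass 1 on every period by \<open>a 0 = 1\<close>, and is
  at most \<tau> away from the integers. The four bounds compare a window of integration with a full
  period, with the peak, or with the tail.\<close>

lemma
  fixes k :: "real \<Rightarrow> real"
  assumes k: "\<And>v. of_real (k v) = trig a K v" and a0: "a 0 = 1" and k0: "\<And>v. k v \<ge> 0"
    and \<eta>: "0 < \<eta>" "\<eta> \<le> 1 / 6" and tail: "\<And>v. \<lbrakk>\<eta> \<le> v; v \<le> 1 - \<eta>\<rbrakk> \<Longrightarrow> k v \<le> \<tau>"
  shows trig_kernel_mass_near_ge: "\<lbrakk>x \<le> - \<eta>; \<eta> \<le> y\<rbrakk> \<Longrightarrow> 1 - \<tau> \<le> integral {x..y} k"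
    and trig_kernel_mass_le_1: "y \<le> x + 1 \<Longrightarrow> integral {x..y} k \<le> 1"
    and trig_kernel_mass_far_le:
      "(\<eta> \<le> x \<and> y \<le> 1 - \<eta>) \<or> (\<eta> - 1 \<le> x \<and> y \<le> - \<eta>) \<Longrightarrow> integral {x..y} k \<le> \<tau>"
    and trig_kernel_integral_nonneg: "0 \<le> integral {x..y} k"
proof -
  have kc: "continuous_on S k" for S by (rule trig_real_continuous[OF k])
  have ki: "k integrable_on {u..w}" for u w by (intro integrable_continuous_interval kc)
  have per: "k (v + 1) = k v" for v
    using trig_periodic[of a K v 1] by (simp flip: k)
  have mass: "integral {u..u + 1} k = 1" for u
  proof -
    have "complex_of_real (integral {u..u + 1} k) = integral {u..u + 1} (\<lambda>v. complex_of_real (k v))"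
      using integral_linear[OF ki bounded_linear_of_real[where 'a = complex], of u "u + 1"] by (simp add: o_def)
    also have "\<dots> = 1" unfolding k using trig_integral_period[of u a K] a0 by simp
    finally show ?thesis by (metis of_real_eq_1_iff)
  qed
  have \<tau>0: "\<tau> \<ge> 0" using order_trans[OF k0 tail[of \<eta>]] \<eta> by simp
  have const: "integral {u..w} k \<le> \<tau>" if "\<And>v. v \<in> {u..w} \<Longrightarrow> k v \<le> \<tau>" "w \<le> u + 1" for u w
  proof (cases "u \<le> w")
    case True
    have "integral {u..w} k \<le> integral {u..w} (\<lambda>_. \<tau>)"
      using that by (intro integral_le ki) auto
    also have "\<dots> = \<tau> * (w - u)" using True by simp
    also have "\<dots> \<le> \<tau> * 1" using that \<tau>0 by (intro mult_left_mono) auto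
    finally show ?thesis by simp
  qed (use \<tau>0 in simp)
  show "0 \<le> integral {x..y} k" using k0 by (intro integral_nonneg ki) auto
  show "integral {x..y} k \<le> 1" if "y \<le> x + 1"
    using integral_subset_le[OF _ ki ki, of x y x "x + 1"] that k0 mass by auto
  show "integral {x..y} k \<le> \<tau>" if h: "(\<eta> \<le> x \<and> y \<le> 1 - \<eta>) \<or> (\<eta> - 1 \<le> x \<and> y \<le> - \<eta>)"
  proof (rule const)
    show "y \<le> x + 1" using h \<eta> by auto
    fix v assume v: "v \<in> {x..y}"
    show "k v \<le> \<tau>"
    proof (cases "\<eta> \<le> x \<and> y \<le> 1 - \<eta>")
      case True then show ?thesis using tail[of v] v by auto
    next
      case False
      \<comment> \<open>The tail bound is stated on one period only; a negative window is moved
        there by periodicity.\<close>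
      then have "k (v + 1) \<le> \<tau>" using h v by (intro tail) auto
      then show ?thesis by (simp add: per)
    qed
  qed
  show "1 - \<tau> \<le> integral {x..y} k" if h: "x \<le> - \<eta>" "\<eta> \<le> y"
  proof -
    \<comment> \<open>A period starting at -\<eta> splits into the peak and a tail of mass at most
      \<tau>.\<close>
    have "integral {-\<eta>..\<eta>} k + integral {\<eta>..-\<eta> + 1} k = 1"
      using Henstock_Kurzweil_Integration.integral_combine[of "-\<eta>" \<eta> "-\<eta> + 1" k] mass[of "-\<eta>"] ki \<eta> by simp
    moreover have "integral {\<eta>..-\<eta> + 1} k \<le> \<tau>"
      using \<eta> tail by (intro const) auto
    moreover have "integral {-\<eta>..\<eta>} k \<le> integral {x..y} k"
      using h k0 by (intro integral_subset_le ki) auto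
    ultimately show ?thesis by simp
  qed
qed

lemma trig_frac: "trig c K (frac x) = trig c K x"
  using trig_periodic[of c K "frac x" "\<lfloor>x\<rfloor>"] by (simp add: frac_def)

text \<open>The interval is widened by \<eta> on both sides before convolving. For
  \<open>frac x\<close> inside the original interval the window of integration then contains the
  whole peak from -\<eta> to \<eta>, hence almost all of the mass.\<close>

lemma interval_majorant:
  assumes n: "n \<ge> 36" and I: "0 \<le> s" "s + d \<le> 1" "d \<ge> 0"
  obtains P :: "real \<Rightarrow> real" and c where
    "\<And>x. of_real (P x) = trig c (r * n) x" "c 0 = of_real (d + 12 / n)"
    "(\<Sum>m\<in>{- int (r * n)..int (r * n)}. norm (c m)) \<le> 12 * real n * 4 ^ r"
    "\<And>x. P x \<ge> 0" "\<And>x. frac x \<in> {s<..<s + d} \<Longrightarrow> 1 - 6 * real n / 9 ^ r \<le> P x"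
proof -
  obtain k a where ka: "\<And>v. of_real (k v) = trig a (r * n) v" "a 0 = 1" "\<And>v. k v \<ge> 0"
    "(\<Sum>m\<in>{- int (r * n)..int (r * n)}. norm (a m)) \<le> 6 * real n * 4 ^ r"
    "\<And>(\<eta> :: real) v. \<lbrakk>0 < \<eta>; \<eta> \<le> 1 / 6; \<eta> \<le> v; v \<le> 1 - \<eta>\<rbrakk> \<Longrightarrow> k v \<le> 6 * real n * (2 / (real n * \<eta>)) ^ (2 * r)"
    by (rule concentrated_kernel[of n r]) (use n in auto)
  \<comment> \<open>This width makes 2 / (n \<eta>) equal to 1/3, so the tail decays like
    \<open>1 / 9 ^ r\<close>; n \<ge> 36 gives \<eta> \<le> 1/6.\<close>
  define \<eta> where "\<eta> = 6 / real n"
  have \<eta>: "0 < \<eta>" "\<eta> \<le> 1 / 6" using n by (auto simp: \<eta>_def field_simps)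
  have "6 * real n * (2 / (real n * \<eta>)) ^ (2 * r) = 6 * real n / 9 ^ r"
    using n by (simp add: \<eta>_def power_divide power_mult)
  then have tail: "k v \<le> 6 * real n / 9 ^ r" if "\<eta> \<le> v" "v \<le> 1 - \<eta>" for v
    using ka(5)[OF \<eta> that] by simp
  obtain c where c: "\<And>x. of_real (integral {x - (s + d + \<eta>)..x - (s - \<eta>)} k) = trig c (r * n) x"
    "c 0 = of_real ((s + d + \<eta>) - (s - \<eta>))" "\<And>m. norm (c m) \<le> norm (a m) * ((s + d + \<eta>) - (s - \<eta>))"
    using trig_convolve_interval[of k a "r * n" "s - \<eta>" "s + d + \<eta>"] ka(1,2) \<eta> I by auto
  show ?thesis
  proof (rule that[OF c(1)])
    show "c 0 = of_real (d + 12 / n)" by (simp add: c(2) \<eta>_def)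
    have "norm (c m) \<le> norm (a m) * 2" for m
      using c(3)[of m] mult_left_mono[of "(s + d + \<eta>) - (s - \<eta>)" 2 "norm (a m)"] I \<eta> by simp
    then have "(\<Sum>m\<in>{- int (r * n)..int (r * n)}. norm (c m)) \<le> (\<Sum>m\<in>{- int (r * n)..int (r * n)}. norm (a m)) * 2"
      unfolding sum_distrib_right by (intro sum_mono)
    then show "(\<Sum>m\<in>{- int (r * n)..int (r * n)}. norm (c m)) \<le> 12 * real n * 4 ^ r"
      using ka(4) by simp
    show "0 \<le> integral {x - (s + d + \<eta>)..x - (s - \<eta>)} k" for x
      by (rule trig_kernel_integral_nonneg[OF ka(1-3) \<eta> tail])
    fix x assume x: "frac x \<in> {s<..<s + d}"
    have "integral {x - (s + d + \<eta>)..x - (s - \<eta>)} k = integral {frac x - (s + d + \<eta>)..frac x - (s - \<eta>)} k"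
      by (metis c(1) trig_frac of_real_eq_iff)
    moreover have "1 - 6 * real n / 9 ^ r \<le> integral {frac x - (s + d + \<eta>)..frac x - (s - \<eta>)} k"
      using x by (intro trig_kernel_mass_near_ge[OF ka(1-3) \<eta> tail]) auto
    ultimately show "1 - 6 * real n / 9 ^ r \<le> integral {x - (s + d + \<eta>)..x - (s - \<eta>)} k" by simp
  qed
qed

text \<open>Here the interval is shrunk by \<eta> on both sides. For \<open>frac x\<close> outside
  the original interval the window of integration stays at distance at least \<eta> from all
  integers and meets only the tail. The result is a minorant of the indicator up to that
  tail.\<close>

lemma interval_minorant:
  assumes n: "n \<ge> 36" and I: "0 \<le> s" "s + d \<le> 1" "d \<ge> 12 / n"
  obtains P :: "real \<Rightarrow> real" and c where
    "\<And>x. of_real (P x) = trig c (r * n) x" "c 0 = of_real (d - 12 / n)"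
    "(\<Sum>m\<in>{- int (r * n)..int (r * n)}. norm (c m)) \<le> 12 * real n * 4 ^ r"
    "\<And>x. P x \<ge> 0" "\<And>x. P x \<le> 1" "\<And>x. frac x \<notin> {s<..<s + d} \<Longrightarrow> P x \<le> 6 * real n / 9 ^ r"
proof -
  obtain k a where ka: "\<And>v. of_real (k v) = trig a (r * n) v" "a 0 = 1" "\<And>v. k v \<ge> 0"
    "(\<Sum>m\<in>{- int (r * n)..int (r * n)}. norm (a m)) \<le> 6 * real n * 4 ^ r"
    "\<And>(\<eta> :: real) v. \<lbrakk>0 < \<eta>; \<eta> \<le> 1 / 6; \<eta> \<le> v; v \<le> 1 - \<eta>\<rbrakk> \<Longrightarrow> k v \<le> 6 * real n * (2 / (real n * \<eta>)) ^ (2 * r)"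
    by (rule concentrated_kernel[of n r]) (use n in auto)
  define \<eta> where "\<eta> = 6 / real n"
  have \<eta>: "0 < \<eta>" "\<eta> \<le> 1 / 6" using n by (auto simp: \<eta>_def field_simps)
  have d\<eta>: "2 * \<eta> \<le> d" using I by (simp add: \<eta>_def)
  have "6 * real n * (2 / (real n * \<eta>)) ^ (2 * r) = 6 * real n / 9 ^ r"
    using n by (simp add: \<eta>_def power_divide power_mult)
  then have tail: "k v \<le> 6 * real n / 9 ^ r" if "\<eta> \<le> v" "v \<le> 1 - \<eta>" for v
    using ka(5)[OF \<eta> that] by simp
  obtain c where c: "\<And>x. of_real (integral {x - (s + d - \<eta>)..x - (s + \<eta>)} k) = trig c (r * n) x"
    "c 0 = of_real ((s + d - \<eta>) - (s + \<eta>))" "\<And>m. norm (c m) \<le> norm (a m) * ((s + d - \<eta>) - (s + \<eta>))"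
    using trig_convolve_interval[of k a "r * n" "s + \<eta>" "s + d - \<eta>"] ka(1,2) d\<eta> by auto
  show ?thesis
  proof (rule that[OF c(1)])
    show "c 0 = of_real (d - 12 / n)" by (simp add: c(2) \<eta>_def)
    have "norm (c m) \<le> norm (a m) * 2" for m
      using c(3)[of m] mult_left_mono[of "(s + d - \<eta>) - (s + \<eta>)" 2 "norm (a m)"] I \<eta> by simp
    then have "(\<Sum>m\<in>{- int (r * n)..int (r * n)}. norm (c m)) \<le> (\<Sum>m\<in>{- int (r * n)..int (r * n)}. norm (a m)) * 2"
      unfolding sum_distrib_right by (intro sum_mono)
    then show "(\<Sum>m\<in>{- int (r * n)..int (r * n)}. norm (c m)) \<le> 12 * real n * 4 ^ r"
      using ka(4) by simp
    show "0 \<le> integral {x - (s + d - \<eta>)..x - (s + \<eta>)} k" for x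
      by (rule trig_kernel_integral_nonneg[OF ka(1-3) \<eta> tail])
    show "integral {x - (s + d - \<eta>)..x - (s + \<eta>)} k \<le> 1" for x
      using I \<eta> by (intro trig_kernel_mass_le_1[OF ka(1-3) \<eta> tail]) auto
    fix x assume x: "frac x \<notin> {s<..<s + d}"
    then have near: "frac x \<le> s \<or> s + d \<le> frac x" by auto
    have "integral {x - (s + d - \<eta>)..x - (s + \<eta>)} k = integral {frac x - (s + d - \<eta>)..frac x - (s + \<eta>)} k"
      by (metis c(1) trig_frac of_real_eq_iff)
    moreover have "integral {frac x - (s + d - \<eta>)..frac x - (s + \<eta>)} k \<le> 6 * real n / 9 ^ r"
    proof (rule trig_kernel_mass_far_le[OF ka(1-3) \<eta> tail])
      show "(\<eta> \<le> frac x - (s + d - \<eta>) \<and> frac x - (s + \<eta>) \<le> 1 - \<eta>) \<or>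
          (\<eta> - 1 \<le> frac x - (s + d - \<eta>) \<and> frac x - (s + \<eta>) \<le> - \<eta>)"
        using near I \<eta> frac_lt_1[of x] frac_ge_0[of x] by linarith
    qed
    ultimately show "integral {x - (s + d - \<eta>)..x - (s + \<eta>)} k \<le> 6 * real n / 9 ^ r" by simp
  qed
qed

section \<open>Mean values of products over primes\<close>

text \<open>Distinct positive integers differ by at least 1, so the logarithm of their ratio is at
  least the reciprocal of the larger one, and the larger is at most the product.\<close>

lemma abs_ln_diff_nat_ge:
  fixes A B :: nat
  assumes "A \<noteq> B" "A > 0" "B > 0" "real A * real B \<le> M"
  shows "1 / M \<le> \<bar>ln (real A) - ln (real B)\<bar>"
proof -
  have main: "1 / M \<le> ln (real a) - ln (real b)" if "b < a" "b > 0" "real a * real b \<le> M" for a b :: nat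
  proof -
    have aM: "real a \<le> M"
    proof -
      have "real a * 1 \<le> real a * real b" using that by (intro mult_left_mono) auto
      then show ?thesis using that by linarith
    qed
    have "1 / M \<le> 1 / real a" using that aM by (intro divide_left_mono) auto
    also have "1 / real a \<le> 1 - real b / real a"
      using that by (simp add: field_simps)
    also have "\<dots> \<le> - ln (real b / real a)"
      using ln_le_minus_one[of "real b / real a"] that by simp
    also have "\<dots> = ln (real a) - ln (real b)" using that by (simp add: ln_div)
    finally show ?thesis .
  qed
  show ?thesis
  proof (cases "B < A")
    case True then show ?thesis using main[of B A] assms by simp
  next
    case False
    then show ?thesis using main[of A B] assms by (simp add: mult.commute)
  qed
qed

text \<open>Separating positive from negative exponents writes the form as ln A - ln B with positive
  integers A and B. They are distinct by unique factorisation, and their product is the product of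
  the powers \<open>q ^ nat \<bar>m q\<bar>\<close>.\<close>

lemma linear_form_log_primes_ge:
  fixes m :: "nat \<Rightarrow> int"
  assumes fin: "finite S" and pr: "\<And>q. q \<in> S \<Longrightarrow> prime q" and le: "\<And>q. q \<in> S \<Longrightarrow> real q \<le> Y"
    and m: "\<And>q. q \<in> S \<Longrightarrow> \<bar>m q\<bar> \<le> int K" and nz: "\<exists>q\<in>S. m q \<noteq> 0" and Y: "Y \<ge> 1"
  shows "1 / Y ^ (K * card S) \<le> \<bar>\<Sum>q\<in>S. of_int (m q) * ln (real q)\<bar>"
proof -
  define A where "A = (\<Prod>q\<in>S. q ^ nat (m q))"
  define B where "B = (\<Prod>q\<in>S. q ^ nat (- m q))"
  have pos: "q > 0" if "q \<in> S" for q using pr[OF that] by (simp add: prime_gt_0_nat)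
  have AB: "A > 0" "B > 0" by (auto simp: A_def B_def pos intro!: prod_pos)
  obtain q where q: "q \<in> S" "m q \<noteq> 0" using nz by auto
  \<comment> \<open>For \<open>m q \<noteq> 0\<close> exactly one of these two multiplicities is 0,
    which separates \<open>A\<close> from \<open>B\<close>.\<close>
  have "multiplicity q A = nat (m q)" "multiplicity q B = nat (- m q)"
    using multiplicity_prod_prime_powers[OF fin pr pr[OF q(1)], of "\<lambda>q. nat (m q)"]
      multiplicity_prod_prime_powers[OF fin pr pr[OF q(1)], of "\<lambda>q. nat (- m q)"] q(1)
    by (simp_all add: A_def B_def)
  then have "A \<noteq> B" using q(2) by auto
  moreover have "real A * real B \<le> Y ^ (K * card S)"
  proof -
    have "real A * real B = (\<Prod>q\<in>S. real q ^ nat \<bar>m q\<bar>)"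
      unfolding A_def B_def of_nat_prod prod.distrib[symmetric] of_nat_power power_add[symmetric]
      by (intro prod.cong) (auto intro!: arg_cong[of _ _ "power _"])
    also have "\<dots> \<le> (\<Prod>q\<in>S. Y ^ K)"
    proof (intro prod_mono conjI)
      fix q assume q: "q \<in> S"
      have "real q ^ nat \<bar>m q\<bar> \<le> Y ^ nat \<bar>m q\<bar>" using le[OF q] by (intro power_mono) auto
      also have "\<dots> \<le> Y ^ K" using m[OF q] Y by (intro power_increasing) auto
      finally show "real q ^ nat \<bar>m q\<bar> \<le> Y ^ K" .
    qed auto
    also have "\<dots> = Y ^ (K * card S)" by (simp add: power_mult)
    finally show ?thesis .
  qed
  ultimately have "1 / Y ^ (K * card S) \<le> \<bar>ln (real A) - ln (real B)\<bar>"
    using AB by (intro abs_ln_diff_nat_ge) auto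
  also have "ln (real A) = (\<Sum>q\<in>S. real (nat (m q)) * ln (real q))"
    unfolding A_def of_nat_prod using fin pos by (subst ln_prod) (auto simp: ln_realpow)
  also have "ln (real B) = (\<Sum>q\<in>S. real (nat (- m q)) * ln (real q))"
    unfolding B_def of_nat_prod using fin pos by (subst ln_prod) (auto simp: ln_realpow)
  also have "(\<Sum>q\<in>S. real (nat (m q)) * ln (real q)) - (\<Sum>q\<in>S. real (nat (- m q)) * ln (real q)) =
      (\<Sum>q\<in>S. of_int (m q) * ln (real q))"
    unfolding sum_subtractf[symmetric] left_diff_distrib[symmetric]
    by (intro sum.cong) auto
  finally show ?thesis .
qed

text \<open>Expanding the product gives one exponential for each vector of indices. The zero vector
  yields the main term; each other frequency is at least \<open>1 / Y ^ (K * card J)\<close> in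
  absolute value, and the norms of all coefficients together sum to at most
  \<open>W ^ card J\<close>.\<close>

lemma mean_value_trig_prod:
  fixes P :: "'j \<Rightarrow> real \<Rightarrow> real" and p :: "'j \<Rightarrow> nat"
  assumes fin: "finite J" and inj: "inj_on p J" and pr: "\<And>j. j \<in> J \<Longrightarrow> prime (p j)"
    and le: "\<And>j. j \<in> J \<Longrightarrow> real (p j) \<le> Y" and Y: "Y \<ge> 1" and T: "T > 0"
    and P: "\<And>j x. j \<in> J \<Longrightarrow> of_real (P j x) = trig (c j) K x"
    and c0: "\<And>j. j \<in> J \<Longrightarrow> c j 0 = of_real (d j)"
    and cW: "\<And>j. j \<in> J \<Longrightarrow> (\<Sum>m\<in>{- int K..int K}. norm (c j m)) \<le> W"
  shows "\<bar>integral {T..2 * T} (\<lambda>t. \<Prod>j\<in>J. P j (t * ln (real (p j)) / (2 * pi))) - T * (\<Prod>j\<in>J. d j)\<bar>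
    \<le> 2 * Y ^ (K * card J) * W ^ card J"
proof -
  define G where "G = (J \<rightarrow>\<^sub>E {- int K..int K})"
  \<comment> \<open>The members of \<open>G\<close> are undefined off \<open>J\<close>, so the zero
    vector must be restricted to \<open>J\<close> to belong to \<open>G\<close>.\<close>
  define g0 :: "'j \<Rightarrow> int" where "g0 = restrict (\<lambda>_. 0) J"
  define F where "F t = (\<Prod>j\<in>J. P j (t * ln (real (p j)) / (2 * pi)))" for t
  define w where "w g = (\<Sum>j\<in>J. of_int (g j) * ln (real (p j)))" for g :: "'j \<Rightarrow> int"
  define C where "C g = (\<Prod>j\<in>J. c j (g j))" for g
  have finG: "finite G" using fin by (auto simp: G_def intro: finite_PiE)
  have g0: "g0 \<in> G" by (auto simp: g0_def G_def)
  have expand: "of_real (F t) = (\<Sum>g\<in>G. C g * cis (w g * t))" for t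
  proof -
    have "of_real (F t) = (\<Prod>j\<in>J. trig (c j) K (t * ln (real (p j)) / (2 * pi)))"
      unfolding F_def of_real_prod using P by (intro prod.cong) auto
    also have "\<dots> = (\<Sum>g\<in>G. \<Prod>j\<in>J. c j (g j) * cis (2 * pi * of_int (g j) * (t * ln (real (p j)) / (2 * pi))))"
      unfolding trig_def G_def by (rule prod_sum_PiE) (auto simp: fin)
    also have "\<dots> = (\<Sum>g\<in>G. \<Prod>j\<in>J. c j (g j) * cis (of_int (g j) * ln (real (p j)) * t))"
      by (simp add: mult.commute mult.left_commute)
    also have "\<dots> = (\<Sum>g\<in>G. C g * cis (w g * t))"
      unfolding C_def prod.distrib prod_cis[OF fin] w_def sum_distrib_right ..
    finally show ?thesis .
  qed
  have "continuous_on {T..2 * T} (\<lambda>t. Re (\<Sum>g\<in>G. C g * cis (w g * t)))"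
    by (intro continuous_on_Re continuous_on_sum continuous_on_mult continuous_on_cis
        continuous_on_const continuous_on_id)
  then have Fc: "continuous_on {T..2 * T} F" by (simp flip: expand)
  have "complex_of_real (integral {T..2 * T} F) = integral {T..2 * T} (\<lambda>t. complex_of_real (F t))"
    using integral_linear[OF integrable_continuous_interval[OF Fc] bounded_linear_of_real[where 'a = complex]]
    by (simp add: o_def)
  also have "\<dots> = (\<Sum>g\<in>G. C g * integral {T..2 * T} (\<lambda>t. cis (w g * t)))"
    unfolding expand using finG
    by (subst integral_sum)
      (auto intro!: integrable_continuous_interval continuous_on_mult continuous_on_cis
        continuous_on_const continuous_on_id)
  also have "\<dots> = C g0 * integral {T..2 * T} (\<lambda>t. cis (w g0 * t)) +
      (\<Sum>g\<in>G - {g0}. C g * integral {T..2 * T} (\<lambda>t. cis (w g * t)))"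
    by (rule sum.remove[OF finG g0])
  also have "C g0 * integral {T..2 * T} (\<lambda>t. cis (w g0 * t)) = of_real (T * (\<Prod>j\<in>J. d j))"
    using T by (simp add: C_def w_def g0_def c0 scaleR_conv_of_real)
  finally have "complex_of_real (integral {T..2 * T} F - T * (\<Prod>j\<in>J. d j)) =
      (\<Sum>g\<in>G - {g0}. C g * integral {T..2 * T} (\<lambda>t. cis (w g * t)))" by simp
  then have "\<bar>integral {T..2 * T} F - T * (\<Prod>j\<in>J. d j)\<bar> =
      norm (\<Sum>g\<in>G - {g0}. C g * integral {T..2 * T} (\<lambda>t. cis (w g * t)))"
    by (metis norm_of_real)
  also have "\<dots> \<le> (\<Sum>g\<in>G - {g0}. norm (C g) * (2 * Y ^ (K * card J)))"
  proof (rule sum_norm_le)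
    fix g assume g: "g \<in> G - {g0}"
    have "\<exists>j\<in>J. g j \<noteq> 0"
    proof (rule ccontr)
      assume "\<not> (\<exists>j\<in>J. g j \<noteq> 0)"
      then have "g = g0" using g by (intro ext) (auto simp: g0_def G_def PiE_def extensional_def)
      then show False using g by simp
    qed
    then obtain j where j: "j \<in> J" "g j \<noteq> 0" by auto
    have gK: "\<bar>g i\<bar> \<le> int K" if "i \<in> J" for i
    proof -
      have "g i \<in> {- int K..int K}" using g that by (auto simp: G_def)
      then show ?thesis by auto
    qed
    \<comment> \<open>The exponents are transported from indices to primes, since the lower bound
      for linear forms is indexed by the primes themselves.\<close>
    define m where "m q = g (the_inv_into J p q)" for q
    have mp: "m (p i) = g i" if "i \<in> J" for i
      using that inj by (simp add: m_def the_inv_into_f_f)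
    have "1 / Y ^ (K * card (p ` J)) \<le> \<bar>\<Sum>q\<in>p ` J. of_int (m q) * ln (real q)\<bar>"
    proof (rule linear_form_log_primes_ge)
      show "\<exists>q\<in>p ` J. m q \<noteq> 0" using j mp by auto
    qed (use fin pr le gK mp Y in auto)
    also have "(\<Sum>q\<in>p ` J. of_int (m q) * ln (real q)) = w g"
      unfolding w_def by (subst sum.reindex[OF inj]) (auto simp: mp)
    finally have lw: "1 / Y ^ (K * card J) \<le> \<bar>w g\<bar>" by (simp add: card_image inj)
    have Yp: "Y ^ (K * card J) > 0" using Y by simp
    then have wpos: "\<bar>w g\<bar> > 0" using lw by (smt (verit) zero_less_divide_1_iff)
    have "norm (integral {T..2 * T} (\<lambda>t. cis (w g * t))) \<le> 2 / \<bar>w g\<bar>"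
      using T wpos by (intro norm_integral_cis_le) auto
    also have "\<dots> \<le> 2 / (1 / Y ^ (K * card J))"
      using lw wpos Yp by (intro divide_left_mono) (auto intro!: divide_pos_pos mult_pos_pos)
    also have "\<dots> = 2 * Y ^ (K * card J)" by simp
    finally show "norm (C g * integral {T..2 * T} (\<lambda>t. cis (w g * t))) \<le> norm (C g) * (2 * Y ^ (K * card J))"
      unfolding norm_mult by (intro mult_left_mono) auto
  qed
  also have "\<dots> \<le> (\<Sum>g\<in>G. norm (C g) * (2 * Y ^ (K * card J)))"
    using finG Y by (intro sum_mono2) auto
  also have "\<dots> = (\<Sum>g\<in>G. \<Prod>j\<in>J. norm (c j (g j))) * (2 * Y ^ (K * card J))"
    by (simp add: C_def sum_distrib_right prod_norm)
  \<comment> \<open>The product expansion is now read backwards: the sum over all vectors factors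
    into one coefficient sum per index.\<close>
  also have "(\<Sum>g\<in>G. \<Prod>j\<in>J. norm (c j (g j))) = (\<Prod>j\<in>J. \<Sum>m\<in>{- int K..int K}. norm (c j m))"
    unfolding G_def by (rule prod_sum_PiE[symmetric]) (auto simp: fin)
  also have "\<dots> * (2 * Y ^ (K * card J)) \<le> (\<Prod>j\<in>J. W) * (2 * Y ^ (K * card J))"
    using cW Y by (intro mult_right_mono prod_mono conjI sum_nonneg) auto
  also have "\<dots> = 2 * Y ^ (K * card J) * W ^ card J" by simp
  finally show ?thesis unfolding F_def .
qed

section \<open>Measure of a box of fractional parts, bounded above and below\<close>

lemma measure_eq_integral_indicator:
  assumes "H \<in> sets lebesgue" "H \<subseteq> {a..b :: real}"
  shows "indicat_real H integrable_on {a..b}" "measure lebesgue H = integral {a..b} (indicat_real H)"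
proof -
  have H: "H \<in> lmeasurable"
    using assms by (intro bounded_set_imp_lmeasurable) (auto intro: bounded_subset[OF bounded_closed_interval])
  have "measure lebesgue H = integral H (\<lambda>x. 1)" by (rule lmeasure_integral[OF H])
  also have "\<dots> = integral {a..b} (\<lambda>x. if x \<in> H then 1 else 0)"
    using assms(2) by (simp add: integral_restrict_Int Int_absorb1 Int_absorb2)
  also have ind: "(\<lambda>x. if x \<in> H then 1 else 0) = indicat_real H" by (auto simp: indicator_def)
  finally show "measure lebesgue H = integral {a..b} (indicat_real H)" .
  have "(\<lambda>x. 1 :: real) integrable_on H" using H by (simp add: lmeasurable_iff_integrable_on)
  then have "(\<lambda>x. if x \<in> H then 1 else 0 :: real) integrable_on {a..b}"
    using assms(2) by (simp add: integrable_restrict_Int Int_absorb1 Int_absorb2)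
  then show "indicat_real H integrable_on {a..b}"
    unfolding ind .
qed

text \<open>The intervals are given by left end and length, and the index set is arbitrary; this
  fixes the data that \<open>hit_set\<close> leaves existential.\<close>

definition box_set :: "real \<Rightarrow> 'j set \<Rightarrow> ('j \<Rightarrow> nat) \<Rightarrow> ('j \<Rightarrow> real) \<Rightarrow> ('j \<Rightarrow> real) \<Rightarrow> real set" where
  "box_set T J p s d =
     {t \<in> {T..2 * T}. \<forall>j\<in>J. frac (t * ln (real (p j)) / (2 * pi)) \<in> {s j<..<s j + d j}}"

lemma box_set_measurable: "finite J \<Longrightarrow> box_set T J p s d \<in> sets lebesgue"
proof -
  assume fin: "finite J"
  have "Measurable.pred borel (\<lambda>t. frac (t * w / (2 * pi)) \<in> {u<..<v})" for w u v :: real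
    unfolding frac_def by measurable
  then have 1: "{t. frac (t * w / (2 * pi)) \<in> {u<..<v}} \<in> sets borel" for w u v :: real
    by (simp add: pred_def)
  have "box_set T J p s d = {T..2 * T} - (\<Union>j\<in>J. - {t. frac (t * ln (real (p j)) / (2 * pi)) \<in> {s j<..<s j + d j}})"
    by (auto simp: box_set_def)
  also have "\<dots> \<in> sets borel"
    using fin 1 by (intro sets.Diff sets.finite_UN borel_comp) auto
  finally show ?thesis by simp
qed

text \<open>The product of the majorants is nonnegative everywhere and at least
  \<open>(1 - 6 * real n / 9 ^ r) ^ card J\<close> on the box; its integral is known from the mean
  value estimate.\<close>

lemma box_set_measure_le:
  fixes T Y :: real and p :: "'j \<Rightarrow> nat" and n r :: nat
  assumes fin: "finite J" and inj: "inj_on p J" and pr: "\<And>j. j \<in> J \<Longrightarrow> prime (p j)"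
    and le: "\<And>j. j \<in> J \<Longrightarrow> real (p j) \<le> Y" and Y: "Y \<ge> 1" and T: "T > 0"
    and I: "\<And>j. j \<in> J \<Longrightarrow> 0 \<le> s j \<and> s j + d j \<le> 1 \<and> 0 \<le> d j"
    and n: "n \<ge> 36" and \<tau>: "6 * real n / 9 ^ r \<le> 1"
  shows "(1 - 6 * real n / 9 ^ r) ^ card J * measure lebesgue (box_set T J p s d) \<le>
    T * (\<Prod>j\<in>J. d j + 12 / n) + 2 * Y ^ (r * n * card J) * (12 * real n * 4 ^ r) ^ card J"
proof -
  define Q where "Q j P c \<longleftrightarrow> (\<forall>x. of_real (P x) = trig c (r * n) x) \<and> c 0 = of_real (d j + 12 / n) \<and>
    (\<Sum>m\<in>{- int (r * n)..int (r * n)}. norm (c m)) \<le> 12 * real n * 4 ^ r \<and>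
    (\<forall>x. P x \<ge> 0) \<and> (\<forall>x. frac x \<in> {s j<..<s j + d j} \<longrightarrow> 1 - 6 * real n / 9 ^ r \<le> P x)" for j P c
  have "\<exists>P c. Q j P c" if "j \<in> J" for j
  proof -
    have h: "0 \<le> s j" "s j + d j \<le> 1" "0 \<le> d j" using I[OF that] by auto
    show ?thesis
    proof (rule interval_majorant[OF n h, of r])
      fix P c assume "\<And>x. of_real (P x) = trig c (r * n) x" "c 0 = of_real (d j + 12 / n)"
        "(\<Sum>m\<in>{- int (r * n)..int (r * n)}. norm (c m)) \<le> 12 * real n * 4 ^ r"
        "\<And>x. P x \<ge> 0" "\<And>x. frac x \<in> {s j<..<s j + d j} \<Longrightarrow> 1 - 6 * real n / 9 ^ r \<le> P x"
      then show ?thesis unfolding Q_def by (intro exI[of _ P] exI[of _ c] conjI allI impI)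
    qed
  qed
  then obtain P c where Q: "\<And>j. j \<in> J \<Longrightarrow> Q j (P j) (c j)" by metis
  have P: "\<And>j x. j \<in> J \<Longrightarrow> of_real (P j x) = trig (c j) (r * n) x"
    "\<And>j. j \<in> J \<Longrightarrow> c j 0 = of_real (d j + 12 / n)"
    "\<And>j. j \<in> J \<Longrightarrow> (\<Sum>m\<in>{- int (r * n)..int (r * n)}. norm (c j m)) \<le> 12 * real n * 4 ^ r"
    "\<And>j x. j \<in> J \<Longrightarrow> P j x \<ge> 0"
    "\<And>j x. \<lbrakk>j \<in> J; frac x \<in> {s j<..<s j + d j}\<rbrakk> \<Longrightarrow> 1 - 6 * real n / 9 ^ r \<le> P j x"
    using Q unfolding Q_def by blast+
  let ?F = "\<lambda>t. \<Prod>j\<in>J. P j (t * ln (real (p j)) / (2 * pi))"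
  have Fc: "continuous_on {T..2 * T} ?F"
    by (intro continuous_on_prod continuous_on_compose2[OF trig_real_continuous[OF P(1)]] continuous_intros) auto
  have sub: "box_set T J p s d \<subseteq> {T..2 * T}" by (auto simp: box_set_def)
  note mi = measure_eq_integral_indicator[OF box_set_measurable[OF fin] sub]
  have "(1 - 6 * real n / 9 ^ r) ^ card J * measure lebesgue (box_set T J p s d) =
      integral {T..2 * T} (\<lambda>t. (1 - 6 * real n / 9 ^ r) ^ card J * indicator (box_set T J p s d) t)"
    unfolding mi(2) by simp
  also have "\<dots> \<le> integral {T..2 * T} ?F"
  proof (rule integral_le)
    show "(\<lambda>t. (1 - 6 * real n / 9 ^ r) ^ card J * indicator (box_set T J p s d) t) integrable_on {T..2 * T}"
      using integrable_on_cmult_left[OF mi(1)] by simp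
    show "?F integrable_on {T..2 * T}" by (rule integrable_continuous_interval[OF Fc])
    fix t
    show "(1 - 6 * real n / 9 ^ r) ^ card J * indicator (box_set T J p s d) t \<le> ?F t"
    proof (cases "t \<in> box_set T J p s d")
      case True
      have "(\<Prod>j\<in>J. 1 - 6 * real n / 9 ^ r) \<le> ?F t"
        using True \<tau> P(5) by (intro prod_mono) (auto simp: box_set_def)
      then show ?thesis using True by simp
    qed (auto intro!: prod_nonneg P(4))
  qed
  also have "\<dots> \<le> T * (\<Prod>j\<in>J. d j + 12 / n) + 2 * Y ^ (r * n * card J) * (12 * real n * 4 ^ r) ^ card J"
  proof -
    have "\<bar>integral {T..2 * T} ?F - T * (\<Prod>j\<in>J. d j + 12 / n)\<bar> \<le>
        2 * Y ^ (r * n * card J) * (12 * real n * 4 ^ r) ^ card J"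
      by (rule mean_value_trig_prod[OF fin inj pr le Y T P(1-3)]) auto
    then show ?thesis by (simp add: abs_le_iff)
  qed
  finally show ?thesis .
qed

text \<open>A product of approximate minorants can be positive off the box. Bounding it there by the
  tail alone would cost a multiple of \<open>T\<close>, which may far exceed the main term.
  Subtracting the tail times the sum of all products with one factor removed gives a true minorant,
  and the mean values of those products keep the loss relative.\<close>

lemma box_set_measure_ge:
  fixes T Y :: real and p :: "'j \<Rightarrow> nat" and n r :: nat
  assumes fin: "finite J" and inj: "inj_on p J" and pr: "\<And>j. j \<in> J \<Longrightarrow> prime (p j)"
    and le: "\<And>j. j \<in> J \<Longrightarrow> real (p j) \<le> Y" and Y: "Y \<ge> 1" and T: "T > 0"
    and I: "\<And>j. j \<in> J \<Longrightarrow> 0 \<le> s j \<and> s j + d j \<le> 1 \<and> 12 / n \<le> d j"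
    and n: "n \<ge> 36"
  defines "E \<equiv> 2 * Y ^ (r * n * card J) * (12 * real n * 4 ^ r) ^ card J"
  shows "T * (\<Prod>j\<in>J. d j - 12 / n) - E -
      6 * real n / 9 ^ r * (\<Sum>i\<in>J. T * (\<Prod>j\<in>J - {i}. d j - 12 / n) + E)
    \<le> measure lebesgue (box_set T J p s d)"
proof -
  define \<tau> where "\<tau> = 6 * real n / 9 ^ r"
  have \<tau>0: "\<tau> \<ge> 0" by (simp add: \<tau>_def)
  define Q where "Q j P c \<longleftrightarrow> (\<forall>x. of_real (P x) = trig c (r * n) x) \<and> c 0 = of_real (d j - 12 / n) \<and>
    (\<Sum>m\<in>{- int (r * n)..int (r * n)}. norm (c m)) \<le> 12 * real n * 4 ^ r \<and>
    (\<forall>x. P x \<ge> 0) \<and> (\<forall>x. P x \<le> 1) \<and> (\<forall>x. frac x \<notin> {s j<..<s j + d j} \<longrightarrow> P x \<le> \<tau>)" for j P c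
  have "\<exists>P c. Q j P c" if "j \<in> J" for j
  proof -
    have h: "0 \<le> s j" "s j + d j \<le> 1" "12 / n \<le> d j" using I[OF that] by auto
    show ?thesis
    proof (rule interval_minorant[OF n h, of r])
      fix P c assume "\<And>x. of_real (P x) = trig c (r * n) x" "c 0 = of_real (d j - 12 / n)"
        "(\<Sum>m\<in>{- int (r * n)..int (r * n)}. norm (c m)) \<le> 12 * real n * 4 ^ r"
        "\<And>x. P x \<ge> 0" "\<And>x. P x \<le> 1"
        "\<And>x. frac x \<notin> {s j<..<s j + d j} \<Longrightarrow> P x \<le> 6 * real n / 9 ^ r"
      then show ?thesis unfolding Q_def \<tau>_def by (intro exI[of _ P] exI[of _ c] conjI allI impI)
    qed
  qed
  then obtain P c where Q: "\<And>j. j \<in> J \<Longrightarrow> Q j (P j) (c j)" by metis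
  have P: "\<And>j x. j \<in> J \<Longrightarrow> of_real (P j x) = trig (c j) (r * n) x"
    "\<And>j. j \<in> J \<Longrightarrow> c j 0 = of_real (d j - 12 / n)"
    "\<And>j. j \<in> J \<Longrightarrow> (\<Sum>m\<in>{- int (r * n)..int (r * n)}. norm (c j m)) \<le> 12 * real n * 4 ^ r"
    "\<And>j x. j \<in> J \<Longrightarrow> P j x \<ge> 0" "\<And>j x. j \<in> J \<Longrightarrow> P j x \<le> 1"
    "\<And>j x. \<lbrakk>j \<in> J; frac x \<notin> {s j<..<s j + d j}\<rbrakk> \<Longrightarrow> P j x \<le> \<tau>"
    using Q unfolding Q_def by blast+
  define F where "F A t = (\<Prod>j\<in>A. P j (t * ln (real (p j)) / (2 * pi)))" for A t
  have Fc: "continuous_on {T..2 * T} (F A)" if "A \<subseteq> J" for A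
    unfolding F_def using that
    by (intro continuous_on_prod continuous_on_compose2[OF trig_real_continuous[OF P(1)]] continuous_intros) auto
  have Fi: "F A integrable_on {T..2 * T}" if "A \<subseteq> J" for A
    by (rule integrable_continuous_interval[OF Fc[OF that]])
  have F0: "F A t \<ge> 0" if "A \<subseteq> J" for A t
    unfolding F_def using that by (intro prod_nonneg P(4)) auto
  \<comment> \<open>This lets the exponent \<open>card A\<close> be raised to \<open>card J\<close>,
    so that one error \<open>E\<close> serves every subset.\<close>
  have W1: "12 * real n * 4 ^ r \<ge> 1"
    using n mult_mono[of 1 "12 * real n" 1 "4 ^ r :: real"] by simp
  have mean: "\<bar>integral {T..2 * T} (F A) - T * (\<Prod>j\<in>A. d j - 12 / n)\<bar> \<le> E" if A: "A \<subseteq> J" for A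
  proof -
    have "\<bar>integral {T..2 * T} (F A) - T * (\<Prod>j\<in>A. d j - 12 / n)\<bar> \<le>
        2 * Y ^ (r * n * card A) * (12 * real n * 4 ^ r) ^ card A"
      unfolding F_def
      by (rule mean_value_trig_prod[OF finite_subset[OF A fin] inj_on_subset[OF inj A] pr le Y T P(1-3)])
        (use A in auto)
    also have "\<dots> \<le> E"
      unfolding E_def using Y W1 card_mono[OF fin A]
      by (intro mult_mono power_increasing mult_left_mono) auto
    finally show ?thesis .
  qed
  have sub: "box_set T J p s d \<subseteq> {T..2 * T}" by (auto simp: box_set_def)
  note mi = measure_eq_integral_indicator[OF box_set_measurable[OF fin] sub]
  have si: "(\<lambda>t. \<tau> * (\<Sum>i\<in>J. F (J - {i}) t)) integrable_on {T..2 * T}"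
    using integrable_on_cmult_left[OF integrable_sum[OF fin Fi], of "\<lambda>i. J - {i}" \<tau>] by simp
  have "integral {T..2 * T} (\<lambda>t. F J t - \<tau> * (\<Sum>i\<in>J. F (J - {i}) t)) \<le>
      integral {T..2 * T} (indicator (box_set T J p s d))"
  proof (rule integral_le)
    show "(\<lambda>t. F J t - \<tau> * (\<Sum>i\<in>J. F (J - {i}) t)) integrable_on {T..2 * T}"
      by (intro integrable_diff Fi si) auto
    show "indicat_real (box_set T J p s d) integrable_on {T..2 * T}" by (rule mi(1))
    fix t assume t: "t \<in> {T..2 * T}"
    have s0: "\<tau> * (\<Sum>i\<in>J. F (J - {i}) t) \<ge> 0"
      using \<tau>0 by (intro mult_nonneg_nonneg sum_nonneg F0) auto
    show "F J t - \<tau> * (\<Sum>i\<in>J. F (J - {i}) t) \<le> indicat_real (box_set T J p s d) t"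
    \<comment> \<open>off the box some factor \<open>P i\<close> is at most \<open>\<tau>\<close>, and the others still form a product with known mean\<close>
    proof (cases "t \<in> box_set T J p s d")
      case True
      have "F J t \<le> 1" unfolding F_def by (intro prod_le_1) (auto simp: P(4,5))
      with s0 show ?thesis using True by simp
    next
      case False
      then obtain i where i: "i \<in> J" "frac (t * ln (real (p i)) / (2 * pi)) \<notin> {s i<..<s i + d i}"
        using t unfolding box_set_def by blast
      have "F J t = P i (t * ln (real (p i)) / (2 * pi)) * F (J - {i}) t"
        unfolding F_def by (rule prod.remove[OF fin i(1)])
      also have "\<dots> \<le> \<tau> * F (J - {i}) t" using P(6)[OF i] by (intro mult_right_mono F0) auto
      also have "\<dots> \<le> \<tau> * (\<Sum>i\<in>J. F (J - {i}) t)"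
        using \<tau>0 i(1) fin by (intro mult_left_mono member_le_sum F0) auto
      finally show ?thesis using False by simp
    qed
  qed
  also have "integral {T..2 * T} (\<lambda>t. F J t - \<tau> * (\<Sum>i\<in>J. F (J - {i}) t)) =
      integral {T..2 * T} (F J) - \<tau> * (\<Sum>i\<in>J. integral {T..2 * T} (F (J - {i})))"
    using fin by (subst integral_diff[OF Fi si]) (auto simp: integral_sum Fi)
  finally have "integral {T..2 * T} (F J) - \<tau> * (\<Sum>i\<in>J. integral {T..2 * T} (F (J - {i})))
      \<le> measure lebesgue (box_set T J p s d)" by (simp add: mi(2))
  moreover have "\<tau> * (\<Sum>i\<in>J. integral {T..2 * T} (F (J - {i}))) \<le>
      \<tau> * (\<Sum>i\<in>J. T * (\<Prod>j\<in>J - {i}. d j - 12 / n) + E)"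
  proof (intro mult_left_mono sum_mono \<tau>0)
    fix i
    show "integral {T..2 * T} (F (J - {i})) \<le> T * (\<Prod>j\<in>J - {i}. d j - 12 / n) + E"
      using mean[of "J - {i}"] by (simp add: abs_le_iff)
  qed
  moreover have "T * (\<Prod>j\<in>J. d j - 12 / n) - E \<le> integral {T..2 * T} (F J)"
    using mean[of J] by (simp add: abs_le_iff)
  ultimately show ?thesis unfolding \<tau>_def by linarith
qed

section \<open>Asymptotics\<close>

lemma nth_prime_prime: "prime (nth_prime j)"
  using enumerate_in_set[OF primes_infinite, of "j - 1"] by (simp add: nth_prime_def)

lemma inj_on_nth_prime: "inj_on nth_prime {1..N}"
proof (rule inj_onI)
  fix i j assume "i \<in> {1..N}" "j \<in> {1..N}" "nth_prime i = nth_prime j"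
  moreover from this have "i - 1 = j - 1"
    unfolding nth_prime_def using inj_enumerate[OF primes_infinite] by (auto dest: injD)
  ultimately show "i = j" by auto
qed

lemma finite_primes_le: "finite {p :: nat. prime p \<and> real p \<le> y}"
  by (rule finite_subset[of _ "{..nat \<lfloor>y\<rfloor>}"]) (auto simp: le_nat_iff le_floor_iff)

text \<open>If the \<open>j\<close>-th prime exceeded \<open>y\<close>, all primes up to
  \<open>y\<close> would be among the first \<open>j - 1\<close>, contradicting j \<le>
  \<pi>(y).\<close>

lemma nth_prime_le:
  assumes "j \<in> {1..prime_pi y}"
  shows "real (nth_prime j) \<le> y"
proof (rule ccontr)
  assume h: "\<not> real (nth_prime j) \<le> y"
  have "{p :: nat. prime p \<and> real p \<le> y} \<subseteq> enumerate {p. prime p} ` {..<j - 1}"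
  proof
    fix q assume "q \<in> {p :: nat. prime p \<and> real p \<le> y}"
    then have q: "prime q" "real q \<le> y" by auto
    obtain i where i: "q = enumerate {p. prime p} i"
      using enumerate_Ex[of "{p. prime p}" q] q(1) primes_infinite by auto
    have "q < nth_prime j" using q(2) h by linarith
    then have "i < j - 1" unfolding i nth_prime_def using primes_infinite by simp
    then show "q \<in> enumerate {p. prime p} ` {..<j - 1}" using i by auto
  qed
  then have "prime_pi y \<le> card (enumerate {p :: nat. prime p} ` {..<j - 1})"
    unfolding prime_pi_def by (intro card_mono) auto
  also have "\<dots> \<le> j - 1" using card_image_le[of "{..<j - 1}"] by simp
  finally show False using assms by auto
qed

lemma prime_pi_le: "y \<ge> 0 \<Longrightarrow> real (prime_pi y) \<le> y"
proof -
  assume y: "y \<ge> 0"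
  have "prime_pi y \<le> card {1..nat \<lfloor>y\<rfloor>}"
    unfolding prime_pi_def
    by (intro card_mono) (auto simp: le_nat_iff le_floor_iff prime_ge_Suc_0_nat)
  then show ?thesis using y by (simp add: le_floor_iff le_nat_iff)
qed

lemma prime_pi_pos: "y \<ge> 2 \<Longrightarrow> prime_pi y \<ge> 1"
proof -
  assume y: "y \<ge> 2"
  have "card {2 :: nat} \<le> prime_pi y"
    unfolding prime_pi_def using y by (intro card_mono finite_primes_le) auto
  then show ?thesis by simp
qed

text \<open>All errors are made relative to the main term: \<open>A\<close> measures the change of
  interval lengths, \<open>B\<close> the kernel tails, and \<open>C\<close> the mean value error,
  compared with \<open>T * \<Delta> ^ card J\<close> because every length is at least
  \<Delta>.\<close>

lemma box_set_ratio_bounds: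
  fixes T Y \<Delta> :: real and p :: "'j \<Rightarrow> nat" and n r :: nat
  assumes fin: "finite J" and inj: "inj_on p J" and pr: "\<And>j. j \<in> J \<Longrightarrow> prime (p j)"
    and le: "\<And>j. j \<in> J \<Longrightarrow> real (p j) \<le> Y" and Y: "Y \<ge> 1" and T: "T > 0"
    and I: "\<And>j. j \<in> J \<Longrightarrow> 0 \<le> s j \<and> s j + d j \<le> 1 \<and> \<Delta> \<le> d j"
    and n: "n \<ge> 36" and \<Delta>: "12 / n \<le> \<Delta>"
    and A: "12 * card J / (n * \<Delta>) \<le> A"
    and B: "6 * real n / 9 ^ r * card J / \<Delta> \<le> B"
    and C: "2 * Y ^ (r * n * card J) * (12 * real n * 4 ^ r) ^ card J \<le> C * T * \<Delta> ^ card J"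
    and \<tau>: "6 * real n / 9 ^ r \<le> 1"
  defines "x \<equiv> measure lebesgue (box_set T J p s d) / (T * (\<Prod>j\<in>J. d j))"
  shows "(1 - B) * x \<le> exp A + C" "1 - A - C - B * (1 + C) \<le> x"
proof -
  define \<tau> where "\<tau> = 6 * real n / 9 ^ r"
  define E where "E = 2 * Y ^ (r * n * card J) * (12 * real n * 4 ^ r) ^ card J"
  define D where "D = (\<Prod>j\<in>J. d j)"
  define m where "m = measure lebesgue (box_set T J p s d)"
  have \<Delta>0: "\<Delta> > 0" using \<Delta> n by (smt (verit) divide_pos_pos of_nat_0_less_iff zero_less_numeral order_less_le_trans)
  have d0: "d j > 0" "\<Delta> \<le> d j" "d j \<le> 1" if "j \<in> J" for j using I[OF that] \<Delta>0 by auto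
  have D0: "D > 0" unfolding D_def using d0 by (intro prod_pos) auto
  have D\<Delta>: "\<Delta> ^ card J \<le> D"
  proof -
    have "(\<Prod>j\<in>J. \<Delta>) \<le> D" unfolding D_def using d0 \<Delta>0 by (intro prod_mono) (auto intro: less_imp_le)
    then show ?thesis by simp
  qed
  have E0: "E \<ge> 0" unfolding E_def using Y by simp
  have C0: "C \<ge> 0"
  proof -
    have "0 \<le> C * (T * \<Delta> ^ card J)" using E0 C unfolding E_def by (simp add: mult.assoc)
    moreover have "0 < T * \<Delta> ^ card J" using T \<Delta>0 by simp
    ultimately show ?thesis by (simp add: zero_le_mult_iff not_le[symmetric])
  qed
  have ED: "E \<le> C * (T * D)"
  proof -
    have "E \<le> C * (T * \<Delta> ^ card J)" using C by (simp add: E_def mult.assoc)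
    also have "\<dots> \<le> C * (T * D)" using D\<Delta> T C0 by (intro mult_left_mono) auto
    finally show ?thesis .
  qed
  have \<tau>0: "\<tau> \<ge> 0" by (simp add: \<tau>_def)
  have m0: "m \<ge> 0" by (simp add: m_def)
  have m: "m = x * (T * D)" using T D0 by (simp add: m_def x_def D_def)
  have x0: "x \<ge> 0" using m0 T D0 by (simp add: x_def flip: m_def D_def)
  have \<tau>N: "\<tau> * card J / \<Delta> \<le> B" using B by (simp add: \<tau>_def)
  \<comment> \<open>With an index at hand, \<Delta> is at most a length \<open>d j\<close>, hence at
    most 1.\<close>
  have J: "real (card J) \<le> card J / \<Delta>" if "J \<noteq> {}"
  proof -
    obtain j where "j \<in> J" using \<open>J \<noteq> {}\<close> by auto
    then have "\<Delta> \<le> 1" using d0[of j] by linarith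
    then show ?thesis using \<Delta>0 mult_left_mono[of \<Delta> 1 "real (card J)"] by (simp add: field_simps)
  qed
  have \<tau>N': "card J * \<tau> \<le> B"
  proof -
    have "card J * \<tau> \<le> card J / \<Delta> * \<tau>"
    proof (cases "J = {}")
      case False
      then show ?thesis by (intro mult_right_mono J \<tau>0)
    qed simp
    then show ?thesis using \<tau>N by (simp add: mult.commute)
  qed
  show "(1 - B) * x \<le> exp A + C"
  proof -
    have "(\<Prod>j\<in>J. d j + 12 / n) \<le> (\<Prod>j\<in>J. d j * exp (12 / (n * \<Delta>)))"
    proof (intro prod_mono conjI)
      fix j assume j: "j \<in> J"
      show "0 \<le> d j + 12 / n" using d0[OF j] by simp
      have "12 / n = \<Delta> * (12 / (n * \<Delta>))" using \<Delta>0 by simp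
      also have "\<dots> \<le> d j * (12 / (n * \<Delta>))" using d0[OF j] \<Delta>0 by (intro mult_right_mono) auto
      finally have "d j + 12 / n \<le> d j * (1 + 12 / (n * \<Delta>))" by (simp add: distrib_left)
      also have "\<dots> \<le> d j * exp (12 / (n * \<Delta>))"
        using d0[OF j] by (intro mult_left_mono exp_ge_add_one_self) auto
      finally show "d j + 12 / n \<le> d j * exp (12 / (n * \<Delta>))" .
    qed
    also have "\<dots> = D * exp (12 * card J / (n * \<Delta>))"
      by (simp add: D_def prod.distrib exp_of_nat_mult[symmetric] mult.commute)
    also have "\<dots> \<le> D * exp A" using A D0 by (intro mult_left_mono) auto
    finally have pr_le: "(\<Prod>j\<in>J. d j + 12 / n) \<le> D * exp A" .
    have "(1 - B) * x * (T * D) \<le> (1 - card J * \<tau>) * m"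
      using \<tau>N' m0 by (simp add: m mult.assoc mult_right_mono)
    \<comment> \<open>Bernoulli's inequality; it requires \<tau> \<le> 1.\<close>
    also have "\<dots> \<le> (1 - \<tau>) ^ card J * m"
      using Bernoulli_inequality[of "- \<tau>" "card J"] \<tau> m0 by (intro mult_right_mono) (auto simp: \<tau>_def)
    also have "\<dots> \<le> T * (\<Prod>j\<in>J. d j + 12 / n) + E"
      unfolding \<tau>_def m_def E_def
      by (rule box_set_measure_le[OF fin inj pr le Y T _ n \<tau>]) (use I \<Delta>0 in force)+
    also have "\<dots> \<le> T * (D * exp A) + C * (T * D)"
      using pr_le ED T by (intro add_mono mult_left_mono) auto
    also have "\<dots> = (exp A + C) * (T * D)" by (simp add: algebra_simps)
    finally show ?thesis using T D0 by simp
  qed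
  show "1 - A - C - B * (1 + C) \<le> x"
  proof -
    have dn: "0 \<le> d j - 12 / n" if "j \<in> J" for j using d0[OF that] \<Delta> by simp
    have ge: "(1 - A) * D \<le> (\<Prod>j\<in>J. d j - 12 / n)"
    proof -
      have "(1 - A) * D \<le> (1 - 12 / (n * \<Delta>)) ^ card J * D"
      proof (rule mult_right_mono)
        have "12 / (n * \<Delta>) \<le> 1" using \<Delta> \<Delta>0 n by (simp add: field_simps)
        then show "1 - A \<le> (1 - 12 / (n * \<Delta>)) ^ card J"
          using Bernoulli_inequality[of "- (12 / (n * \<Delta>))" "card J"] A by (simp add: mult.commute)
      qed (use D0 in simp)
      also have "\<dots> = (\<Prod>j\<in>J. d j * (1 - 12 / (n * \<Delta>)))"
        by (simp add: D_def prod.distrib mult.commute)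
      also have "\<dots> \<le> (\<Prod>j\<in>J. d j - 12 / n)"
      proof (intro prod_mono conjI)
        fix j assume j: "j \<in> J"
        have "12 / (n * \<Delta>) \<le> 1" using \<Delta> \<Delta>0 n by (simp add: field_simps)
        then show "0 \<le> d j * (1 - 12 / (n * \<Delta>))" using d0[OF j] by (intro mult_nonneg_nonneg) auto
        have "12 / n = \<Delta> * (12 / (n * \<Delta>))" using \<Delta>0 by simp
        also have "\<dots> \<le> d j * (12 / (n * \<Delta>))" using d0[OF j] \<Delta>0 by (intro mult_right_mono) auto
        finally show "d j * (1 - 12 / (n * \<Delta>)) \<le> d j - 12 / n" by (simp add: right_diff_distrib)
      qed
      finally show ?thesis .
    qed
    \<comment> \<open>Removing one factor costs at most 1 / \<Delta>, which explains the division by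
      \<Delta> in the bound for \<open>B\<close>.\<close>
    have rem: "(\<Prod>j\<in>J - {i}. d j - 12 / n) \<le> D / \<Delta>" if i: "i \<in> J" for i
    proof -
      have "(\<Prod>j\<in>J - {i}. d j - 12 / n) \<le> (\<Prod>j\<in>J - {i}. d j)"
        using dn by (intro prod_mono) auto
      also have "\<dots> = D / d i"
        unfolding D_def using prod.remove[OF fin i, of d] d0(1)[OF i] by simp
      also have "\<dots> \<le> D / \<Delta>" using d0[OF i] \<Delta>0 D0 by (intro divide_left_mono) auto
      finally show ?thesis .
    qed
    have "\<tau> * (\<Sum>i\<in>J. T * (\<Prod>j\<in>J - {i}. d j - 12 / n) + E) \<le> \<tau> * (\<Sum>i\<in>J. T * (D / \<Delta>) + C * (T * D))"
      using rem ED T \<tau>0 by (intro mult_left_mono sum_mono add_mono) auto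
    also have "\<dots> = (\<tau> * card J / \<Delta> + C * (card J * \<tau>)) * (T * D)"
      by (simp add: algebra_simps)
    also have "\<dots> \<le> (B + C * B) * (T * D)"
      using \<tau>N \<tau>N' C0 T D0 by (intro mult_right_mono add_mono mult_left_mono) auto
    finally have s: "\<tau> * (\<Sum>i\<in>J. T * (\<Prod>j\<in>J - {i}. d j - 12 / n) + E) \<le> (B + C * B) * (T * D)" .
    have "(1 - A - C - B * (1 + C)) * (T * D) = T * ((1 - A) * D) - C * (T * D) - (B + C * B) * (T * D)"
      by (simp add: algebra_simps)
    also have "\<dots> \<le> T * (\<Prod>j\<in>J. d j - 12 / n) - E - \<tau> * (\<Sum>i\<in>J. T * (\<Prod>j\<in>J - {i}. d j - 12 / n) + E)"
      using ge ED s T by (intro diff_mono mult_left_mono) auto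
    also have "\<dots> \<le> m"
      unfolding \<tau>_def m_def E_def
      by (rule box_set_measure_ge[OF fin inj pr le Y T _ n]) (use I \<Delta> in force)+
    finally show ?thesis using T D0 unfolding m by simp
  qed
qed

section \<open>Choice of parameters and numerical bounds\<close>

lemma nine_power_ge:
  assumes "3 * l \<le> real r"
  shows "exp (6 * l) \<le> 9 ^ r"
proof -
  have "exp (6 * l) \<le> exp (real r * 2)" using assms by simp
  also have "\<dots> = exp 2 ^ r" by (rule exp_of_nat_mult)
  also have "exp 2 = exp (1 :: real) ^ 2" by (simp flip: exp_of_nat_mult)
  also have "(exp (1 :: real) ^ 2) ^ r \<le> (3 ^ 2) ^ r" using exp_le by (intro power_mono) auto
  finally show ?thesis by simp
qed

lemma four_power_le: "4 ^ r \<le> exp (3 / 2 * real r)"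
proof -
  have "(4 :: real) \<le> exp (3 / 2)"
  proof -
    \<comment> \<open>The exponent 16 is large enough: (1 + 3/32) to the power 16 is about
      4.2.\<close>
    have "(4 :: real) \<le> (1 + (3 / 2) / real 16) ^ 16" by (simp add: power_numeral_reduce)
    also have "\<dots> \<le> exp (3 / 2)" by (rule exp_ge_one_plus_x_over_n_power_n) auto
    finally show ?thesis .
  qed
  then have "(4 :: real) ^ r \<le> exp (3 / 2) ^ r" by (intro power_mono) auto
  also have "\<dots> = exp (3 / 2 * real r)" by (simp add: exp_of_nat_mult[symmetric] mult.commute)
  finally show ?thesis .
qed

text \<open>The three relative errors become functions of \<open>T\<close> alone, with no dependence
  on \<open>y\<close>, the intervals or their lengths. This is what yields uniformity.\<close>

lemma hit_ratio_bounds: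
  fixes T y :: real
  defines "L \<equiv> ln T" and "l \<equiv> loglog T"
  assumes T: "T > 1" and L: "L \<ge> 400000" and l: "l \<ge> 1" and A1: "192 * l powr (- (1 / 3)) \<le> 1"
    and B1: "l powr (5 / 3) / L ^ 5 \<le> 1"
    and y: "y > 2" "y \<le> sqrt L / l\<^sup>2"
    and I: "\<forall>j\<in>{1..prime_pi y}. \<delta> j > 0 \<and> (\<exists>a. I j = {a<..<a + \<delta> j}) \<and> I j \<subseteq> {0<..<1} \<and>
         \<delta> j > l powr (- (5 / 3))"
  defines "A \<equiv> 192 * l powr (- (1 / 3))" and "B \<equiv> l powr (5 / 3) / L ^ 5"
    and "C \<equiv> 2 * exp (10 * sqrt L - 3 / 4 * L)"
    and "x \<equiv> hit_measure T y I / (T * (\<Prod>j\<in>{1..prime_pi y}. \<delta> j))"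
  shows "(1 - B) * x \<le> exp A + C" "1 - A - C - B * (1 + C) \<le> x"
proof -
  define M where "M = sqrt L"
  define N where "N = prime_pi y"
  \<comment> \<open>The degree \<open>K = r n\<close> of the trigonometric polynomials is of order \<open>l sqrt L\<close>: small enough that
    \<open>y ^ (K N) \<le> T powr (1 / 4)\<close>, yet large enough that the relative smoothing error \<open>N / (n \<Delta>)\<close>
    is of order \<open>l powr (- 1 / 3)\<close>.\<close>
  define n where "n = nat \<lfloor>M / 8\<rfloor>"
  define r where "r = nat \<lceil>3 * l\<rceil>"
  define \<Delta> where "\<Delta> = l powr (- (5 / 3))"
  have M2: "M\<^sup>2 = L" using L by (simp add: M_def)
  \<comment> \<open>Large enough that rounding down M / 8 leaves at least M / 16, and that M / 16
    \<ge> 36.\<close>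
  have M: "M \<ge> 600"
    unfolding M_def using L real_le_rsqrt[of 600 L] by simp
  have Ll: "exp l = L" using L by (simp add: L_def l_def)
  have M_exp: "M = exp (l / 2)"
  proof (rule power2_eq_imp_eq)
    show "M\<^sup>2 = (exp (l / 2))\<^sup>2" by (simp add: M2 Ll flip: exp_of_nat_mult)
  qed (use M in auto)
  have n: "M / 16 \<le> n" "n \<le> M / 8" using M unfolding n_def by linarith+
  have n36: "n \<ge> 36" using n(1) M by linarith
  \<comment> \<open>The lower bound gives 9 ^ r \<ge> L ^ 6, the upper one controls the degree;
    rounding up fits because l \<ge> 1.\<close>
  have r: "3 * l \<le> r" "r \<le> 4 * l" using l unfolding r_def by linarith+
  have \<Delta>0: "\<Delta> > 0" using l by (simp add: \<Delta>_def)
  have Ny: "real N \<le> y" using prime_pi_le[of y] y by (simp add: N_def)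
  have NM: "real N \<le> M / l\<^sup>2" using Ny y by (simp add: M_def)
  have N1: "real N \<ge> 1" using prime_pi_pos[of y] y by (simp add: N_def)
  have l2: "l\<^sup>2 \<ge> 1" using l by simp
  have Ml: "M / l\<^sup>2 \<le> M"
    using mult_left_mono[OF l2, of M] M l by (simp add: divide_le_eq)
  have "\<exists>s. \<forall>j\<in>{1..N}. I j = {s j<..<s j + \<delta> j}" using I by (intro bchoice) (auto simp: N_def)
  then obtain s where s: "\<And>j. j \<in> {1..N} \<Longrightarrow> I j = {s j<..<s j + \<delta> j}" by auto
  have sI: "0 \<le> s j \<and> s j + \<delta> j \<le> 1 \<and> \<Delta> \<le> \<delta> j" if "j \<in> {1..N}" for j
  proof -
    have "\<delta> j > 0" "I j \<subseteq> {0<..<1}" "\<Delta> < \<delta> j" using I that by (auto simp: N_def \<Delta>_def)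
    moreover from this have "{s j<..<s j + \<delta> j} \<subseteq> {0<..<1}" using s[OF that] by simp
    ultimately show ?thesis by (auto simp: greaterThanLessThan_subseteq_greaterThanLessThan)
  qed
  have hit: "hit_measure T y I = measure lebesgue (box_set T {1..N} nth_prime s \<delta>)"
    unfolding hit_measure_def hit_set_def box_set_def N_def[symmetric]
    using s by (intro arg_cong[of _ _ "measure lebesgue"]) auto
  \<comment> \<open>The decisive balance: \<open>N\<close> is at most M / l ^ 2 and \<open>n\<close>
    at least M / 16, so 192 = 12 * 16, and l ^ 2 times \<Delta> leaves the power 2 - 5/3 = 1/3 of
    \<open>l\<close>.\<close>
  have bA: "12 * real N / (n * \<Delta>) \<le> A"
  proof -
    have "12 * real N / (n * \<Delta>) \<le> 12 * (M / l\<^sup>2) / (M / 16 * \<Delta>)"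
      using NM n \<Delta>0 M l by (intro frac_le mult_right_mono mult_left_mono) auto
    also have "\<dots> = 192 * (1 / (l\<^sup>2 * \<Delta>))" using M by simp
    also have "l\<^sup>2 * \<Delta> = l powr (1 / 3)"
      using l by (simp add: \<Delta>_def powr_add[symmetric] flip: powr_numeral)
    also have "192 * (1 / l powr (1 / 3)) = A" by (simp add: A_def powr_minus_divide)
    finally show ?thesis .
  qed
  \<comment> \<open>Since y > 2 gives N \<ge> 1, the error of a single factor is at most A \<le>
    1.\<close>
  have \<Delta>n: "12 / n \<le> \<Delta>"
  proof -
    have "12 * 1 / (n * \<Delta>) \<le> 12 * real N / (n * \<Delta>)"
      using N1 \<Delta>0 by (intro divide_right_mono) auto
    then have "12 / (n * \<Delta>) \<le> 1" using bA A1 by (simp add: A_def)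
    then show ?thesis using \<Delta>0 n36 by (simp add: field_simps)
  qed
  \<comment> \<open>Numerator \<open>n * N\<close> is of order at most M ^ 2 = L, against 9 ^ r
    \<ge> L ^ 6; this leaves the fifth power of \<open>L\<close>.\<close>
  have bB: "6 * real n / 9 ^ r * N / \<Delta> \<le> B"
  proof -
    have "exp (6 * l) = L ^ 6" using exp_of_nat_mult[of 6 l] by (simp add: Ll)
    then have "L ^ 6 \<le> 9 ^ r" using nine_power_ge[OF r(1)] by simp
    then have "6 * real n / 9 ^ r \<le> M / L ^ 6" using n(2) M L by (intro frac_le) auto
    moreover have "real N \<le> M" using NM Ml by linarith
    ultimately have "6 * real n / 9 ^ r * N / \<Delta> \<le> M / L ^ 6 * M / \<Delta>"
      using M L \<Delta>0 by (intro divide_right_mono mult_mono) auto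
    also have "\<dots> = B"
      using M2 L by (simp add: B_def \<Delta>_def powr_minus field_simps power2_eq_square power_numeral_reduce)
    finally show ?thesis .
  qed
  have \<tau>: "6 * real n / 9 ^ r \<le> 1"
  proof -
    have "\<Delta> \<le> 1" using powr_mono[of "- (5 / 3)" 0 l] l by (simp add: \<Delta>_def)
    then have "1 \<le> real N / \<Delta>" using N1 \<Delta>0 by simp
    then have "6 * real n / 9 ^ r * 1 \<le> 6 * real n / 9 ^ r * (N / \<Delta>)" by (intro mult_left_mono) auto
    also have "\<dots> \<le> B" using bB by simp
    also have "B \<le> 1" using B1 by (simp add: B_def)
    finally show ?thesis by simp
  qed
  \<comment> \<open>Frequencies cost exp (L / 4), coefficient sums exp (8 M), and the small main
    term exp (2 M), all set against T = exp L.\<close>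
  have bC: "2 * y ^ (r * n * N) * (12 * real n * 4 ^ r) ^ N \<le> C * T * \<Delta> ^ N"
  proof -
    have y_le: "y \<le> exp (l / 2)"
using y(2) Ml M_exp by (simp add: M_def)
    have "y ^ (r * n * N) \<le> exp (l / 2) ^ (r * n * N)" using y_le y by (intro power_mono) auto
    also have "\<dots> = exp (real r * real n * real N * (l / 2))" by (simp flip: exp_of_nat_mult)
    also have "\<dots> \<le> exp (L / 4)"
    proof -
      have "real r * real n * real N * (l / 2) \<le> (4 * l) * (M / 8) * (M / l\<^sup>2) * (l / 2)"
        using r n NM l M by (intro mult_mono mult_nonneg_nonneg) auto
      also have "\<dots> = L / 4" using l by (simp add: power2_eq_square flip: M2)
      finally show ?thesis by simp
    qed
    finally have 1: "y ^ (r * n * N) \<le> exp (L / 4)" .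
    have "12 * real n * 4 ^ r \<le> exp (8 * l)"
    proof -
      have "12 * real n * 4 ^ r \<le> (2 * M) * exp (3 / 2 * real r)"
        using n M four_power_le[of r] by (intro mult_mono[of "12 * real n" "2 * M"]) auto
      also have "\<dots> \<le> (exp 1 * exp (l / 2)) * exp (6 * l)"
        using exp_ge_add_one_self[of 1] r M_exp by (intro mult_mono) auto
      also have "\<dots> = exp (1 + l / 2 + 6 * l)" by (simp only: exp_add)
      \<comment> \<open>From l \<ge> 1, the exponent is at most 7.5 l.\<close>
      also have "\<dots> \<le> exp (8 * l)" using l by simp
      finally show ?thesis .
    qed
    then have "(12 * real n * 4 ^ r) ^ N \<le> exp (8 * l) ^ N" by (intro power_mono) auto
    also have "\<dots> = exp (real N * (8 * l))" by (simp flip: exp_of_nat_mult)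
    also have "\<dots> \<le> exp (8 * M)"
    proof -
      have "real N * (8 * l) \<le> (M / l\<^sup>2) * (8 * l)" using NM l by (intro mult_right_mono) auto
      also have "\<dots> = 8 * M / l" using l by (simp add: power2_eq_square)
      also have "\<dots> \<le> 8 * M" using l M by (simp add: field_simps)
      finally show ?thesis by simp
    qed
    finally have 2: "(12 * real n * 4 ^ r) ^ N \<le> exp (8 * M)" .
    have 3: "exp (- (2 * M)) \<le> \<Delta> ^ N"
    proof -
      have "ln l \<le> l" using ln_le_minus_one[of l] l by simp
      then have "real N * (5 / 3 * ln l) \<le> (M / l\<^sup>2) * (5 / 3 * l)"
        using NM l M by (intro mult_mono) auto
      also have "\<dots> = 5 / 3 * M / l" using l by (simp add: power2_eq_square)
      also have "\<dots> \<le> 2 * M" using l M by (simp add: field_simps mult_mono)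
      finally have "exp (- (2 * M)) \<le> exp (real N * (- (5 / 3) * ln l))" by simp
      also have "\<dots> = \<Delta> ^ N" using l by (simp only: \<Delta>_def powr_def exp_of_nat_mult) simp
      finally show ?thesis .
    qed
    have "2 * y ^ (r * n * N) * (12 * real n * 4 ^ r) ^ N \<le> 2 * exp (L / 4) * exp (8 * M)"
      using 1 2 y by (intro mult_mono) auto
    also have "\<dots> = 2 * exp (10 * M - 3 / 4 * L) * exp L * exp (- (2 * M))"
      by (simp add: mult.assoc flip: exp_add)
    also have "\<dots> = C * T * exp (- (2 * M))" using T by (simp add: C_def M_def L_def)
    also have "\<dots> \<le> C * T * \<Delta> ^ N" using 3 T by (intro mult_left_mono) (auto simp: C_def)
    finally show ?thesis .
  qed
  note bounds = box_set_ratio_bounds[of "{1..N}" nth_prime y T s \<delta> \<Delta> n A r B C]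
  have pre: "\<And>j. j \<in> {1..N} \<Longrightarrow> real (nth_prime j) \<le> y" by (simp add: N_def nth_prime_le)
  show "(1 - B) * x \<le> exp A + C"
    unfolding x_def hit N_def[symmetric]
    by (rule bounds(1)) (use inj_on_nth_prime nth_prime_prime pre y T sI n36 \<Delta>n bA bB bC \<tau> in auto)
  show "1 - A - C - B * (1 + C) \<le> x"
    unfolding x_def hit N_def[symmetric]
    by (rule bounds(2)) (use inj_on_nth_prime nth_prime_prime pre y T sI n36 \<Delta>n bA bB bC \<tau> in auto)
qed

text \<open>Uniformity is expressed by quantifying \<open>y\<close>, \<open>I\<close> and
  \<open>\<delta>\<close> inside the eventuality, so the threshold for \<open>T\<close> depends on
  \<epsilon> only.\<close>

theorem mainTheorem4:
  shows "\<forall>\<epsilon>>0. \<forall>\<^sub>F T :: real in at_top.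
    \<forall>(y :: real) (I :: nat \<Rightarrow> real set) (\<delta> :: nat \<Rightarrow> real).
      y > 2 \<and> y \<le> sqrt (ln T) / (loglog T)\<^sup>2 \<and>
      (\<forall>j\<in>{1..prime_pi y}.
         \<delta> j > 0 \<and> (\<exists>a. I j = {a<..<a + \<delta> j}) \<and> I j \<subseteq> {0<..<1} \<and>
         \<delta> j > loglog T powr (- (5 / 3)))
      \<longrightarrow> \<bar>hit_measure T y I / (T * (\<Prod>j\<in>{1..prime_pi y}. \<delta> j)) - 1\<bar> < (\<epsilon> :: real)"
proof (intro allI impI)
  fix \<epsilon> :: real assume \<epsilon>: "\<epsilon> > 0"
  define A where "A T = 192 * loglog T powr (- (1 / 3))" for T
  define B where "B T = loglog T powr (5 / 3) / ln T ^ 5" for T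
  define C where "C T = 2 * exp (10 * sqrt (ln T) - 3 / 4 * ln T)" for T
  \<comment> \<open>\<open>A\<close>, \<open>B\<close> and \<open>C\<close> all tend to 0, so the
    upper and the lower bound for the ratio both tend to 1.\<close>
  have "((\<lambda>T. (exp (A T) + C T) / (1 - B T)) \<longlongrightarrow> 1) at_top"
    unfolding A_def B_def C_def by real_asymp
  then have up: "\<forall>\<^sub>F T in at_top. (exp (A T) + C T) / (1 - B T) < 1 + \<epsilon>"
    using \<epsilon> by (intro order_tendstoD) auto
  have "((\<lambda>T. 1 - A T - C T - B T * (1 + C T)) \<longlongrightarrow> 1) at_top"
    unfolding A_def B_def C_def by real_asymp
  then have lo: "\<forall>\<^sub>F T in at_top. 1 - \<epsilon> < 1 - A T - C T - B T * (1 + C T)"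
    using \<epsilon> by (intro order_tendstoD) auto
  have A1: "\<forall>\<^sub>F T in at_top. A T \<le> 1" unfolding A_def by real_asymp
  \<comment> \<open>Strict, because the upper bound is divided by \<open>1 - B T\<close>.\<close>
  have B1: "\<forall>\<^sub>F T in at_top. B T < 1" unfolding B_def by real_asymp
  have L: "\<forall>\<^sub>F T :: real in at_top. ln T \<ge> 400000" by real_asymp
  have l: "\<forall>\<^sub>F T in at_top. loglog T \<ge> 1" by real_asymp
  show "\<forall>\<^sub>F T :: real in at_top.
    \<forall>(y :: real) (I :: nat \<Rightarrow> real set) (\<delta> :: nat \<Rightarrow> real).
      y > 2 \<and> y \<le> sqrt (ln T) / (loglog T)\<^sup>2 \<and>
      (\<forall>j\<in>{1..prime_pi y}.
         \<delta> j > 0 \<and> (\<exists>a. I j = {a<..<a + \<delta> j}) \<and> I j \<subseteq> {0<..<1} \<and>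
         \<delta> j > loglog T powr (- (5 / 3)))
      \<longrightarrow> \<bar>hit_measure T y I / (T * (\<Prod>j\<in>{1..prime_pi y}. \<delta> j)) - 1\<bar> < \<epsilon>"
    using up lo A1 B1 L l eventually_gt_at_top[of 1]
  proof (eventually_elim, intro allI impI, elim conjE)
    fix T y :: real and I :: "nat \<Rightarrow> real set" and \<delta> :: "nat \<Rightarrow> real"
    assume T: "(exp (A T) + C T) / (1 - B T) < 1 + \<epsilon>"
      "1 - \<epsilon> < 1 - A T - C T - B T * (1 + C T)" "A T \<le> 1" "B T < 1" "ln T \<ge> 400000" "loglog T \<ge> 1" "T > 1"
      and h: "y > 2" "y \<le> sqrt (ln T) / (loglog T)\<^sup>2" "\<forall>j\<in>{1..prime_pi y}.
         \<delta> j > 0 \<and> (\<exists>a. I j = {a<..<a + \<delta> j}) \<and> I j \<subseteq> {0<..<1} \<and>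
         \<delta> j > loglog T powr (- (5 / 3))"
    have B1: "loglog T powr (5 / 3) / ln T ^ 5 \<le> 1" using T(4) by (simp add: B_def)
    note b = hit_ratio_bounds[OF T(7,5,6) T(3)[unfolded A_def] B1 h, folded A_def B_def C_def]
    define x where "x = hit_measure T y I / (T * (\<Prod>j\<in>{1..prime_pi y}. \<delta> j))"
    have "x \<le> (exp (A T) + C T) / (1 - B T)"
      using b(1) T(4) by (simp add: x_def pos_le_divide_eq mult.commute)
    moreover have "1 - \<epsilon> < x" using b(2) T(2) by (simp add: x_def)
    ultimately have "\<bar>x - 1\<bar> < \<epsilon>" using T(1) by linarith
    then show "\<bar>hit_measure T y I / (T * (\<Prod>j\<in>{1..prime_pi y}. \<delta> j)) - 1\<bar> < \<epsilon>"
      by (simp only: x_def)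
  qed
qed

end
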